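(* Let $\delta>1/2$, $H=H(\delta)$, $f_0\in L^2$, and let $\Pi$ be a prior on $L^2$ satisfying the weak Bernstein--von Mises phenomenon in $H$ at $f_0$, i.e. $\beta(\Pi_n\circ\tau_{\mathbb X^{(n)}}^{-1},\mathcal N)\to0$ in $P_{f_0}^n$-probability. Let $L=\langle\cdot,g_L\rangle$ be a linear functional on $L^2$ where $0\ne g_L\in H^s_2$, $s>1/2$, and let $\Pi_n^L=\Pi_n\circ L^{-1}$. Let $\beta_{\mathbb R}$ be the bounded Lipschitz metric for weak convergence on $\mathbb R$, and define $\theta_t:x\mapsto\sqrt n(x-t)$ for $t,x\in\mathbb R$. Then, as $n\to\infty$, $$\beta_{\mathbb R}\big(\Pi_n^L\circ\theta_{L(\mathbb X^{(n)})}^{-1},\,N(0,\|g_L\|_2^2)\big)\to0\quad\text{in }P_{f_0}^n\text{-probability}.$$ Moreover, for $0<\alpha<1$ let $R_n=R(\mathbb X^{(n)},L,\alpha)$ be such that $\Pi_n^L(z:|z-L(\mathbb X^{(n)})|\le R_n/\sqrt n)=1-\alpha$ and let $C_n=\{z:|z-L(\mathbb X^{(n)})|\le R_n/\sqrt n\}$. Then, as $n\to\infty$, $$P_{f_0}^n(L(f_0)\in C_n)\to1-\alpha\quad\text{and}\quad R_n=O_P(1).$$ If, in addition, the posterior mean $\bar f_n$ of $\Pi(\cdot\mid\mathbb X^{(n)})$ satisfies $\|\bar f_n-\mathbb X^{(n)}\|_H=o_P(n^{-1/2})$, then the same result holds true if $C_n$ is centered at $L(\bar f_n)$.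
   Context: Basis. $L^2=L^2([0,1])$, $\langle f,g\rangle=\int_0^1 f\bar g$. Fix an $S$-regular ($S\in\mathbb N$, $S>s$) orthonormal basis $\{\psi_{lk}: l\in\mathcal L,k\in\mathcal Z_l\}$ of $L^2$ ($\mathcal L,\mathcal Z_l\subset\mathbb Z$) with characteristic sequence $a_l$, meaning that every $\psi_{lk}$ is $S$-times differentiable with all derivatives in $L^2$ and either (a) $|\mathcal Z_l|=1$ and $a_l=\max(2,|l|)$, or (b) $\mathcal L\subset\mathbb N=\{1,2,\dots\}$ and $a_l=|\mathcal Z_l|=2^l$. For $0\le s<S$, $H^s_2=\{f\in L^2:\|f\|_{s,2}^2=\sum_l a_l^{2s}\sum_k|\langle\psi_{lk},f\rangle|^2<\infty\}$. Space $H$. For $\delta>1/2$, $H(\delta)$ is the Hilbert space of linear forms $f$ on $\mathrm{span}\{\psi_{lk}\}$ (identified with their coefficients $\langle f,\psi_{lk}\rangle$) with $\|f\|_{H(\delta)}^2=\sum_{l}a_l^{-1}(\log a_l)^{-2\delta}\sum_{k}|\langle f,\psi_{lk}\rangle|^2<\infty$. It contains $L^2$. For $g_L\in H^s_2$, $s>1/2$, the functional $L=\langle\cdot,g_L\rangle$ extends continuously from $L^2$ to $H(\delta)$, and $L(\mathbb X^{(n)})$ is the value of this extension. Standard white noise $\mathbb W$, with i.i.d. $N(0,1)$ coefficients in the basis, is a tight centered Gaussian Borel random variable in $H(\delta)$; its law is $\mathcal N$. Model. For $f\in L^2$, $P_f^n$ is the law of $\mathbb X^{(n)}=f+n^{-1/2}\mathbb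 W$ in $H(\delta)$. A prior $\Pi$ is a Borel probability measure on $L^2$; the posterior $\Pi_n=\Pi(\cdot\mid\mathbb X^{(n)})$ is the conditional law of $f$ given $\mathbb X^{(n)}$ when $f\sim\Pi$, $\mathbb X^{(n)}\mid f\sim P_f^n$ (Bayes' formula with likelihood $dP_f^n/dP_0^n=\exp(n\langle f,\mathbb X^{(n)}\rangle-\tfrac n2\|f\|_2^2)$), also viewed as a measure on $H(\delta)$; $\bar f_n=\int f\,d\Pi_n(f)$ (Bochner integral). The posterior is studied when $\mathbb X^{(n)}\sim P_{f_0}^n$; $o_P,O_P$ refer to $P_{f_0}^n$. Weak Bernstein--von Mises phenomenon. $\tau_z(f)=\sqrt n(f-z)$ on $H$; on a metric space $T$ the bounded Lipschitz metric is $\sup_u|\int u\,d(\mu-\nu)|$ over $u:T\to\mathbb R$ with $\sup|u|+\mathrm{Lip}(u)\le1$; it is written $\beta$ for $T=H$ and $\beta_{\mathbb R}$ for $T=\mathbb R$. *)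

theory Defs
  imports "HOL-Probability.Probability"
begin

abbreviation lebI :: "real measure" where
  "lebI \<equiv> lebesgue_on {0..1}"

text \<open>
  All functions are real-valued, so the conjugate in the inner product is omitted. The elements
  of \<open>L2\<close> are functions, not classes modulo null sets; accordingly \<open>L2_norm\<close> is a seminorm.
\<close>

definition L2 :: "(real \<Rightarrow> real) set" where
  "L2 = {f \<in> borel_measurable lebI. integrable lebI (\<lambda>x. (f x)\<^sup>2)}"

definition L2_inner :: "(real \<Rightarrow> real) \<Rightarrow> (real \<Rightarrow> real) \<Rightarrow> real" where
  "L2_inner f g = (\<integral>x. f x * g x \<partial>lebI)"

definition L2_norm :: "(real \<Rightarrow> real) \<Rightarrow> real" where
  "L2_norm f = sqrt (L2_inner f f)"

definition L2_dist :: "(real \<Rightarrow> real) \<Rightarrow> (real \<Rightarrow> real) \<Rightarrow> real" where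
  "L2_dist f g = L2_norm (\<lambda>x. f x - g x)"

definition metric_borel :: "'a set \<Rightarrow> ('a \<Rightarrow> 'a \<Rightarrow> real) \<Rightarrow> 'a measure" where
  "metric_borel X d = sigma X {U. U \<subseteq> X \<and> (\<forall>x\<in>U. \<exists>r>0. \<forall>y\<in>X. d x y < r \<longrightarrow> y \<in> U)}"

text \<open>
  Open sets of the seminorm are unions of almost-everywhere classes, so measures on \<open>L2_borel\<close>
  are the same thing as Borel measures on the quotient Hilbert space.
\<close>

definition L2_borel :: "(real \<Rightarrow> real) measure" where
  "L2_borel = metric_borel L2 L2_dist"

record basis =
  levels :: "int set"
  shifts :: "int \<Rightarrow> int set"
  psi :: "int \<Rightarrow> int \<Rightarrow> real \<Rightarrow> real"
  char_seq :: "int \<Rightarrow> real"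

definition indices :: "basis \<Rightarrow> (int \<times> int) set" where
  "indices B = Sigma (levels B) (shifts B)"

definition orthonormal_basis :: "basis \<Rightarrow> bool" where
  "orthonormal_basis B \<longleftrightarrow>
     (\<forall>(l, k)\<in>indices B. psi B l k \<in> L2) \<and>
     (\<forall>(l, k)\<in>indices B. \<forall>(l', k')\<in>indices B.
        L2_inner (psi B l k) (psi B l' k') = (if (l, k) = (l', k') then 1 else 0)) \<and>
     (\<forall>f\<in>L2. \<forall>e>0. \<exists>F c. finite F \<and> F \<subseteq> indices B \<and>
        L2_dist f (\<lambda>x. \<Sum>(l, k)\<in>F. c (l, k) * psi B l k x) < e)"

definition times_differentiable_L2 :: "nat \<Rightarrow> (real \<Rightarrow> real) \<Rightarrow> bool" where
  "times_differentiable_L2 S f \<longleftrightarrow>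
     (\<exists>D :: nat \<Rightarrow> real \<Rightarrow> real. (\<forall>x\<in>{0..1}. D 0 x = f x) \<and>
        (\<forall>j<S. \<forall>x\<in>{0..1}. (D j has_real_derivative D (Suc j) x) (at x within {0..1})) \<and>
        (\<forall>j\<le>S. D j \<in> L2))"

definition regular_basis :: "nat \<Rightarrow> basis \<Rightarrow> bool" where
  "regular_basis S B \<longleftrightarrow>
     orthonormal_basis B \<and>
     (\<forall>(l, k)\<in>indices B. times_differentiable_L2 S (psi B l k)) \<and>
     ((\<forall>l\<in>levels B. card (shifts B l) = 1 \<and> char_seq B l = max 2 (real_of_int \<bar>l\<bar>)) \<or>
      (levels B \<subseteq> {1..} \<and>
       (\<forall>l\<in>levels B. char_seq B l = 2 ^ nat l \<and> card (shifts B l) = 2 ^ nat l)))"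

definition sobolev :: "basis \<Rightarrow> real \<Rightarrow> (real \<Rightarrow> real) set" where
  "sobolev B s = {f \<in> L2.
     (\<lambda>(l, k). char_seq B l powr (2 * s) * (L2_inner (psi B l k) f)\<^sup>2) summable_on indices B}"

text \<open>
  A linear form on the span of the basis is given by its family of coefficients, which is
  extended by \<open>0\<close> outside the index set so that equal forms are equal functions.
\<close>

type_synonym form = "int \<times> int \<Rightarrow> real"

definition coef :: "basis \<Rightarrow> (real \<Rightarrow> real) \<Rightarrow> form" where
  "coef B f = (\<lambda>(l, k). if (l, k) \<in> indices B then L2_inner f (psi B l k) else 0)"

definition H_term :: "basis \<Rightarrow> real \<Rightarrow> form \<Rightarrow> int \<times> int \<Rightarrow> real" where
  "H_term B \<delta> x = (\<lambda>(l, k).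
     inverse (char_seq B l) * ln (char_seq B l) powr (- 2 * \<delta>) * (x (l, k))\<^sup>2)"

definition H_space :: "basis \<Rightarrow> real \<Rightarrow> form set" where
  "H_space B \<delta> = {x. (\<forall>i. i \<notin> indices B \<longrightarrow> x i = 0) \<and> H_term B \<delta> x summable_on indices B}"

definition H_norm :: "basis \<Rightarrow> real \<Rightarrow> form \<Rightarrow> real" where
  "H_norm B \<delta> x = sqrt (infsum (H_term B \<delta> x) (indices B))"

definition H_dist :: "basis \<Rightarrow> real \<Rightarrow> form \<Rightarrow> form \<Rightarrow> real" where
  "H_dist B \<delta> x y = H_norm B \<delta> (\<lambda>i. x i - y i)"

definition H_borel :: "basis \<Rightarrow> real \<Rightarrow> form measure" where
  "H_borel B \<delta> = metric_borel (H_space B \<delta>) (H_dist B \<delta>)"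

text \<open>
  The continuous extension of \<open>\<lambda>f. L2_inner f g\<close> from \<open>L2\<close> (embedded by \<open>coef\<close>) to \<open>H_space B \<delta>\<close>.
\<close>

definition L_ext :: "basis \<Rightarrow> real \<Rightarrow> (real \<Rightarrow> real) \<Rightarrow> form \<Rightarrow> real" where
  "L_ext B \<delta> g x = (THE v. \<forall>F :: nat \<Rightarrow> real \<Rightarrow> real.
     (\<forall>j. F j \<in> L2) \<and> (\<lambda>j. H_dist B \<delta> (coef B (F j)) x) \<longlonglongrightarrow> 0 \<longrightarrow>
     (\<lambda>j. L2_inner (F j) g) \<longlonglongrightarrow> v)"

text \<open>
  The \<open>H\<close>-valued Bochner integral, defined by approximation with simple functions exactly as
  \<^const>\<open>has_bochner_integral\<close>, which is not applicable since \<open>H_space B \<delta>\<close> is not a type.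
\<close>

definition has_H_integral ::
    "basis \<Rightarrow> real \<Rightarrow> 'a measure \<Rightarrow> ('a \<Rightarrow> form) \<Rightarrow> form \<Rightarrow> bool" where
  "has_H_integral B \<delta> M f m \<longleftrightarrow>
     f \<in> M \<rightarrow>\<^sub>M H_borel B \<delta> \<and> m \<in> H_space B \<delta> \<and>
     (\<exists>\<sigma> :: nat \<Rightarrow> 'a \<Rightarrow> form.
        (\<forall>j. simple_function M (\<sigma> j) \<and> \<sigma> j \<in> space M \<rightarrow> H_space B \<delta>) \<and>
        (\<lambda>j. \<integral>\<^sup>+x. ennreal (H_dist B \<delta> (f x) (\<sigma> j x)) \<partial>M) \<longlonglongrightarrow> 0 \<and>
        (\<lambda>j. H_dist B \<delta>
           (\<lambda>i. \<Sum>y\<in>\<sigma> j ` space M. measure M {x \<in> space M. \<sigma> j x = y} * y i) m) \<longlonglongrightarrow> 0)"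

definition white_noise_law :: "basis \<Rightarrow> real \<Rightarrow> form measure \<Rightarrow> bool" where
  "white_noise_law B \<delta> N \<longleftrightarrow>
     N \<in> space (prob_algebra (H_borel B \<delta>)) \<and>
     prob_space.indep_vars N (\<lambda>_. borel) (\<lambda>i w. w i) (indices B) \<and>
     (\<forall>i\<in>indices B. distr N borel (\<lambda>w. w i) = density lborel std_normal_density)"

definition obs_law ::
    "basis \<Rightarrow> real \<Rightarrow> form measure \<Rightarrow> nat \<Rightarrow> (real \<Rightarrow> real) \<Rightarrow> form measure" where
  "obs_law B \<delta> N n f = distr N (H_borel B \<delta>) (\<lambda>w i. coef B f i + w i / sqrt (real n))"

text \<open>
  \<open>\<kappa>\<close> is a regular conditional law of \<open>f\<close> given the observation when \<open>f\<close> has law \<open>Prior\<close>; the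
  marginal law of the observation is \<open>Prior \<bind> obs_law B \<delta> N n\<close>. Any two versions, in particular
  the one given by Bayes' formula, agree outside a null set of that marginal, which is a null
  set of every \<open>obs_law B \<delta> N n f\<close> as well.
\<close>

definition is_posterior ::
    "basis \<Rightarrow> real \<Rightarrow> form measure \<Rightarrow> (real \<Rightarrow> real) measure \<Rightarrow> nat \<Rightarrow>
     (form \<Rightarrow> (real \<Rightarrow> real) measure) \<Rightarrow> bool" where
  "is_posterior B \<delta> N Prior n \<kappa> \<longleftrightarrow>
     \<kappa> \<in> H_borel B \<delta> \<rightarrow>\<^sub>M prob_algebra L2_borel \<and>
     (\<forall>A\<in>sets L2_borel. \<forall>C\<in>sets (H_borel B \<delta>).
        (\<integral>\<^sup>+f\<in>A. emeasure (obs_law B \<delta> N n f) C \<partial>Prior) =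
        (\<integral>\<^sup>+x\<in>C. emeasure (\<kappa> x) A \<partial>(Prior \<bind> obs_law B \<delta> N n)))"

definition bl_dist :: "'a set \<Rightarrow> ('a \<Rightarrow> 'a \<Rightarrow> real) \<Rightarrow> 'a measure \<Rightarrow> 'a measure \<Rightarrow> real" where
  "bl_dist T d \<mu> \<nu> =
     (SUP u \<in> {u :: 'a \<Rightarrow> real. \<exists>b\<ge>0. \<exists>c\<ge>0. b + c \<le> 1 \<and> (\<forall>x\<in>T. \<bar>u x\<bar> \<le> b) \<and>
                 (\<forall>x\<in>T. \<forall>y\<in>T. \<bar>u x - u y\<bar> \<le> c * d x y)}.
        \<bar>(\<integral>x. u x \<partial>\<mu>) - (\<integral>x. u x \<partial>\<nu>)\<bar>)"

text \<open>
  The outer measure coincides with the measure on measurable sets; it is used because \<open>Y n\<close> may be an uncountable supremum such as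
  \<open>bl_dist\<close>, and \<^const>\<open>measure\<close> would be \<open>0\<close> on a set not known to be measurable.
\<close>

definition tends_to_0_in_prob :: "(nat \<Rightarrow> 'a measure) \<Rightarrow> (nat \<Rightarrow> 'a \<Rightarrow> real) \<Rightarrow> bool" where
  "tends_to_0_in_prob P Y \<longleftrightarrow>
     (\<forall>e>0. (\<lambda>n. outer_measure_of (P n) {x \<in> space (P n). \<bar>Y n x\<bar> > e}) \<longlonglongrightarrow> 0)"

text \<open>Sequences start at \<open>n = 1\<close> throughout.\<close>

definition bounded_in_prob :: "(nat \<Rightarrow> 'a measure) \<Rightarrow> (nat \<Rightarrow> 'a \<Rightarrow> real) \<Rightarrow> bool" where
  "bounded_in_prob P Y \<longleftrightarrow>
     (\<forall>e>0. \<exists>K. \<forall>n\<ge>1. measure (P n) {x \<in> space (P n). \<bar>Y n x\<bar> > K} \<le> e)"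

definition weak_BvM ::
    "basis \<Rightarrow> real \<Rightarrow> form measure \<Rightarrow> (nat \<Rightarrow> form \<Rightarrow> (real \<Rightarrow> real) measure) \<Rightarrow>
     (real \<Rightarrow> real) \<Rightarrow> bool" where
  "weak_BvM B \<delta> N post f0 \<longleftrightarrow>
     tends_to_0_in_prob (\<lambda>n. obs_law B \<delta> N n f0)
       (\<lambda>n x. bl_dist (H_space B \<delta>) (H_dist B \<delta>)
          (distr (distr (post n x) (H_borel B \<delta>) (coef B))
             (H_borel B \<delta>) (\<lambda>h i. sqrt (real n) * (h i - x i)))
          N)"

definition post_L :: "(real \<Rightarrow> real) \<Rightarrow> (real \<Rightarrow> real) measure \<Rightarrow> real measure" where
  "post_L g \<mu> = distr \<mu> borel (\<lambda>f. L2_inner f g)"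

definition cred_set :: "(nat \<Rightarrow> form \<Rightarrow> real) \<Rightarrow> (nat \<Rightarrow> form \<Rightarrow> real) \<Rightarrow> nat \<Rightarrow> form \<Rightarrow> real set" where
  "cred_set c R n x = {z. \<bar>z - c n x\<bar> \<le> R n x / sqrt (real n)}"

definition cred_radius ::
    "(nat \<Rightarrow> form measure) \<Rightarrow> (nat \<Rightarrow> form \<Rightarrow> real measure) \<Rightarrow> (nat \<Rightarrow> form \<Rightarrow> real) \<Rightarrow> real \<Rightarrow>
     (nat \<Rightarrow> form \<Rightarrow> real) \<Rightarrow> bool" where
  "cred_radius P Q c \<alpha> R \<longleftrightarrow>
     (\<forall>n\<ge>1. R n \<in> borel_measurable (P n) \<and>
        (AE x in P n. measure (Q n x) (cred_set c R n x) = 1 - \<alpha>))"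

definition coverage_tends ::
    "(nat \<Rightarrow> form measure) \<Rightarrow> real \<Rightarrow> (nat \<Rightarrow> form \<Rightarrow> real set) \<Rightarrow> real \<Rightarrow> bool" where
  "coverage_tends P t C p \<longleftrightarrow>
     (\<lambda>n. measure (P n) {x \<in> space (P n). t \<in> C n x}) \<longlonglongrightarrow> p"

definition is_posterior_mean ::
    "basis \<Rightarrow> real \<Rightarrow> (nat \<Rightarrow> form measure) \<Rightarrow> (nat \<Rightarrow> form \<Rightarrow> (real \<Rightarrow> real) measure) \<Rightarrow>
     (nat \<Rightarrow> form \<Rightarrow> form) \<Rightarrow> bool" where
  "is_posterior_mean B \<delta> P post fbar \<longleftrightarrow>
     (\<forall>n\<ge>1. fbar n \<in> P n \<rightarrow>\<^sub>M H_borel B \<delta> \<and>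
        (AE x in P n. has_H_integral B \<delta> (post n x) (coef B) (fbar n x)))"

end

theory Submission
  imports Defs
begin

text \<open>
  Since \<open>2 s > 1\<close>, Cauchy-Schwarz with the weights of \<open>H(\<delta>)\<close> shows that \<open>L\<close> extends to the Lipschitz
  functional \<open>x \<mapsto> \<Sum>i. x i * g i\<close> on \<open>H(\<delta>)\<close>. A Lipschitz map increases the bounded Lipschitz metric
  by at most a constant factor, and the law of \<open>L\<close> under white noise is \<open>N(0, \<parallel>g\<parallel>\<^sup>2)\<close> (limit of the characteristic
  functions of the partial sums and Parseval), which gives the convergence of the standardised
  posterior of \<open>L\<close>. Testing with trapezoidal functions, the radii then converge in probability to the
  quantile \<open>q\<close> with \<open>N(0, \<parallel>g\<parallel>\<^sup>2)[-q, q] = 1 - \<alpha>\<close>, for any centring within \<open>o(1 / sqrt n)\<close> of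
  \<open>L(X)\<close>. Under the true law \<open>sqrt n (L(X) - L(f0))\<close> is exactly \<open>N(0, \<parallel>g\<parallel>\<^sup>2)\<close>, so the coverage
  tends to \<open>1 - \<alpha>\<close>.
\<close>

subsection \<open>Borel sets of a metric and the bounded Lipschitz metric\<close>

text \<open>The forms are a set of functions with a distance, not a type with a topology, so Borel
  sets are generated explicitly and measurability comes from Lipschitz bounds. As a function of the
  observation the bounded Lipschitz distance is an uncountable supremum; convergence in probability
  is therefore propagated by pointwise implications between variables, through measurable hulls of
  exceptional sets. The radius is known only through an equation. Strict growth of the normal mass
  of \<open>[-r, r]\<close> in \<open>r\<close> turns closeness of laws and centres into closeness
  of radii. Coverage then depends on the radius only through its limit \<open>q\<close>, so a radius
  calibrated around one centre may be used around another; the posterior mean is treated in this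
  way.\<close>

lemma space_metric_borel [simp]: "space (metric_borel X d) = X"
  unfolding metric_borel_def by (rule space_measure_of) auto

text \<open>Preimages of open sets are open, with radius \<open>r / (K + 1)\<close>, where the added
  1 covers \<open>K = 0\<close>. As \<open>d\<close> and \<open>d'\<close> are arbitrary functions
  on sets, the seminorm distance on \<open>L2\<close>, the distance on \<open>H_space\<close> and
  the distance of a metric type are all covered.\<close>

lemma measurable_metric_borel_Lipschitz:
  assumes f: "f \<in> X \<rightarrow> Y" and K: "0 \<le> K"
    and lip: "\<And>x y. x \<in> X \<Longrightarrow> y \<in> X \<Longrightarrow> d' (f x) (f y) \<le> K * d x y"
  shows "f \<in> metric_borel X d \<rightarrow>\<^sub>M metric_borel Y d'"
proof -
  have "f -` U \<inter> X \<in> sets (metric_borel X d)"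
    if U: "U \<subseteq> Y" "\<forall>x\<in>U. \<exists>r>0. \<forall>y\<in>Y. d' x y < r \<longrightarrow> y \<in> U" for U
  proof -
    have "\<exists>r>0. \<forall>y\<in>X. d x y < r \<longrightarrow> y \<in> f -` U \<inter> X" if x: "x \<in> f -` U \<inter> X" for x
    proof -
      from x U(2) obtain r where r: "r > 0" "\<And>y. y \<in> Y \<Longrightarrow> d' (f x) y < r \<Longrightarrow> y \<in> U"
        by (metis IntD1 vimageE)
      have "y \<in> f -` U \<inter> X" if y: "y \<in> X" "d x y < r / (K + 1)" for y
      proof -
        have "K * d x y \<le> K * (r / (K + 1))"
          using y K by (intro mult_left_mono) auto
        also have "\<dots> < r"
          using r(1) K by (simp add: field_simps)
        finally show ?thesis
          using r(2)[of "f y"] lip[of x y] x y f by auto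
      qed
      moreover have "r / (K + 1) > 0"
        using r K by simp
      ultimately show ?thesis by blast
    qed
    then show ?thesis
      unfolding metric_borel_def by (auto intro!: sigma_sets.Basic)
  qed
  then show ?thesis
    using f unfolding metric_borel_def[of Y d'] by (intro measurable_measure_of) auto
qed

text \<open>Lets the Lipschitz criterion above be used for maps into a metric type, in particular
  for real functionals.\<close>

lemma borel_eq_metric_borel: "(borel :: 'a::metric_space measure) = metric_borel UNIV dist"
proof -
  have "{S :: 'a set. open S} = {U. U \<subseteq> UNIV \<and> (\<forall>x\<in>U. \<exists>r>0. \<forall>y\<in>UNIV. dist x y < r \<longrightarrow> y \<in> U)}"
    by (simp add: open_dist dist_commute)
  then show ?thesis
    unfolding borel_def metric_borel_def by simp
qed

text \<open>Valid without integrability of \<open>u\<close>, since the integral is 0 by convention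
  otherwise. The test functions in \<open>bl_dist\<close> come without a measurability
  condition.\<close>

lemma abs_integral_le_bound:
  assumes "prob_space \<mu>" "0 \<le> b" "\<And>x. x \<in> space \<mu> \<Longrightarrow> \<bar>u x\<bar> \<le> b"
  shows "\<bar>\<integral>x. u x \<partial>\<mu>\<bar> \<le> (b :: real)"
proof -
  interpret prob_space \<mu> by fact
  have "\<bar>\<integral>x. u x \<partial>\<mu>\<bar> \<le> (\<integral>x. \<bar>u x\<bar> \<partial>\<mu>)"
    by (rule integral_abs_bound)
  also have "\<dots> \<le> (\<integral>x. b \<partial>\<mu>)"
    using assms by (intro integral_mono') auto
  finally show ?thesis by (simp add: prob_space)
qed

lemma bl_dist_upper:
  assumes "prob_space \<mu>" "prob_space \<nu>" "space \<mu> = T" "space \<nu> = T"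
    and "0 \<le> b" "0 \<le> c" "b + c \<le> 1" "\<And>x. x \<in> T \<Longrightarrow> \<bar>u x\<bar> \<le> b"
    and "\<And>x y. x \<in> T \<Longrightarrow> y \<in> T \<Longrightarrow> \<bar>u x - u y\<bar> \<le> c * d x y"
  shows "\<bar>(\<integral>x. u x \<partial>\<mu>) - (\<integral>x. u x \<partial>\<nu>)\<bar> \<le> bl_dist T d \<mu> \<nu>"
  unfolding bl_dist_def
proof (rule cSUP_upper)
  show "u \<in> {u. \<exists>b\<ge>0. \<exists>c\<ge>0. b + c \<le> 1 \<and> (\<forall>x\<in>T. \<bar>u x\<bar> \<le> b) \<and>
                 (\<forall>x\<in>T. \<forall>y\<in>T. \<bar>u x - u y\<bar> \<le> c * d x y)}"
    using assms by blast
  show "bdd_above ((\<lambda>u. \<bar>(\<integral>x. u x \<partial>\<mu>) - (\<integral>x. u x \<partial>\<nu>)\<bar>) `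
      {u. \<exists>b\<ge>0. \<exists>c\<ge>0. b + c \<le> 1 \<and> (\<forall>x\<in>T. \<bar>u x\<bar> \<le> b) \<and>
                 (\<forall>x\<in>T. \<forall>y\<in>T. \<bar>u x - u y\<bar> \<le> c * d x y)})"
  \<comment> \<open>A real supremum is informative only over a bounded set. Each of the two
    integrals is at most \<open>b\<close> in modulus, and \<open>b\<close> is at most 1.\<close>
  proof (rule bdd_aboveI2[where M = 2], clarify)
    fix u :: "'a \<Rightarrow> real" and b c :: real
    assume bc: "0 \<le> b" "0 \<le> c" "b + c \<le> 1" and u: "\<forall>x\<in>T. \<bar>u x\<bar> \<le> b"
    have "\<bar>\<integral>x. u x \<partial>\<mu>\<bar> \<le> b" "\<bar>\<integral>x. u x \<partial>\<nu>\<bar> \<le> b"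
      using assms bc u by (auto intro!: abs_integral_le_bound)
    with bc show "\<bar>(\<integral>x. u x \<partial>\<mu>) - (\<integral>x. u x \<partial>\<nu>)\<bar> \<le> 2"
      by linarith
  qed
qed

lemma bl_dist_nonneg:
  assumes "prob_space \<mu>" "prob_space \<nu>" "space \<mu> = T" "space \<nu> = T"
  shows "0 \<le> bl_dist T d \<mu> \<nu>"
  using bl_dist_upper[OF assms, of 0 0 "\<lambda>_. 0" d] by simp

lemma bl_dist_commute: "bl_dist T d \<mu> \<nu> = bl_dist T d \<nu> \<mu>"
  unfolding bl_dist_def by (simp add: abs_minus_commute)

text \<open>If \<open>u\<close> is a test function on the target, then \<open>u\<close> after
  \<phi>, divided by \<open>K\<close>, is one on \<open>T\<close> with the same constants
  \<open>b\<close> and \<open>c\<close>: the factor \<open>K\<close> gained in the Lipschitz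
  constant cancels, and \<open>1 \<le> K\<close> keeps the supremum below \<open>b\<close>.\<close>

lemma bl_dist_distr_Lipschitz:
  fixes \<phi> :: "'a \<Rightarrow> 'b::metric_space"
  assumes "prob_space \<mu>" "prob_space \<nu>" "space \<mu> = T" "space \<nu> = T"
    and m: "\<phi> \<in> \<mu> \<rightarrow>\<^sub>M borel" "\<phi> \<in> \<nu> \<rightarrow>\<^sub>M borel"
    and K: "1 \<le> K" and lip: "\<And>x y. x \<in> T \<Longrightarrow> y \<in> T \<Longrightarrow> dist (\<phi> x) (\<phi> y) \<le> K * d x y"
  shows "bl_dist UNIV dist (distr \<mu> borel \<phi>) (distr \<nu> borel \<phi>) \<le> K * bl_dist T d \<mu> \<nu>"
proof -
  have "\<bar>(\<integral>x. u x \<partial>distr \<mu> borel \<phi>) - (\<integral>x. u x \<partial>distr \<nu> borel \<phi>)\<bar> \<le> K * bl_dist T d \<mu> \<nu>"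
    if bc: "0 \<le> b" "0 \<le> c" "b + c \<le> 1" and u: "\<And>x. \<bar>u x\<bar> \<le> b"
      "\<And>x y. \<bar>u x - u y\<bar> \<le> c * dist x y" for b c and u :: "'b \<Rightarrow> real"
  proof -
    \<comment> \<open>The integrals are to be moved along \<phi>, which requires a measurable
      \<open>u\<close>; on a metric type the Lipschitz bound supplies this.\<close>
    have um: "u \<in> borel_measurable borel"
      unfolding borel_eq_metric_borel
      by (rule measurable_metric_borel_Lipschitz[where K = c]) (use bc u in \<open>auto simp: dist_real_def\<close>)
    let ?v = "\<lambda>x. u (\<phi> x) / K"
    have "\<bar>(\<integral>x. ?v x \<partial>\<mu>) - (\<integral>x. ?v x \<partial>\<nu>)\<bar> \<le> bl_dist T d \<mu> \<nu>"
    proof (rule bl_dist_upper[where b = b and c = c])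
      fix x assume "x \<in> T"
      show "\<bar>?v x\<bar> \<le> b"
        using u(1)[of "\<phi> x"] K mult_left_mono[OF K bc(1)] by (simp add: field_simps)
    next
      fix x y assume xy: "x \<in> T" "y \<in> T"
      have "\<bar>u (\<phi> x) - u (\<phi> y)\<bar> \<le> c * (K * d x y)"
        using u(2)[of "\<phi> x" "\<phi> y"] mult_left_mono[OF lip[OF xy] bc(2)] by linarith
      then show "\<bar>?v x - ?v y\<bar> \<le> c * d x y"
        using K by (simp add: diff_divide_distrib[symmetric] field_simps)
    qed (use assms bc in auto)
    then have "\<bar>((\<integral>x. u (\<phi> x) \<partial>\<mu>) - (\<integral>x. u (\<phi> x) \<partial>\<nu>)) / K\<bar> \<le> bl_dist T d \<mu> \<nu>"
      by (simp add: diff_divide_distrib)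
    then have "\<bar>(\<integral>x. u (\<phi> x) \<partial>\<mu>) - (\<integral>x. u (\<phi> x) \<partial>\<nu>)\<bar> \<le> K * bl_dist T d \<mu> \<nu>"
      using K by (simp add: field_simps)
    then show ?thesis
      using m um by (simp add: integral_distr)
  qed
  then show ?thesis
    unfolding bl_dist_def[of UNIV] by (intro cSUP_least) (auto intro!: exI[of _ "\<lambda>_. 0"] exI[of _ 0])
qed

text \<open>An indicator is not Lipschitz, so it is replaced by a function that is 1 on
  \<open>[-a, a]\<close>, vanishes outside \<open>[-a - e, a + e]\<close> and has slope
  \<open>1 / e\<close>. Supremum plus Lipschitz constant is at most \<open>1 + 1 / e\<close>, and
  division by this number gives an admissible test function. The bound also holds for negative
  \<open>a\<close>.\<close>

lemma measure_abs_le_bl_dist: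
  fixes \<mu> \<nu> :: "real measure"
  assumes "prob_space \<mu>" "prob_space \<nu>" and [measurable_cong]: "sets \<mu> = sets borel" "sets \<nu> = sets borel"
    and e: "0 < e"
  shows "measure \<mu> {z. \<bar>z\<bar> \<le> a} \<le> measure \<nu> {z. \<bar>z\<bar> \<le> a + e} + (1 + 1 / e) * bl_dist UNIV dist \<mu> \<nu>"
proof -
  interpret \<mu>: prob_space \<mu> by fact
  interpret \<nu>: prob_space \<nu> by fact
  have sp: "space \<mu> = UNIV" "space \<nu> = UNIV"
    using sets_eq_imp_space_eq[OF assms(3)] sets_eq_imp_space_eq[OF assms(4)] by simp_all
  define K where "K = 1 + 1 / e"
  have K: "K > 0" using e by (simp add: K_def add_pos_pos)
  define t where "t = (\<lambda>z :: real. max 0 (min 1 ((a + e - \<bar>z\<bar>) / e)))"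
  have tm [measurable]: "t \<in> borel_measurable borel"
    unfolding t_def by measurable
  have t01: "0 \<le> t z" "t z \<le> 1" for z by (auto simp: t_def)
  have tlip: "\<bar>t x - t y\<bar> \<le> (1 / e) * \<bar>x - y\<bar>" for x y
  proof -
    have "\<bar>t x - t y\<bar> \<le> \<bar>(a + e - \<bar>x\<bar>) / e - (a + e - \<bar>y\<bar>) / e\<bar>"
      unfolding t_def by linarith
    also have "\<dots> = \<bar>\<bar>x\<bar> - \<bar>y\<bar>\<bar> / e"
      using e by (simp add: diff_divide_distrib[symmetric] abs_minus_commute)
    also have "\<dots> \<le> \<bar>x - y\<bar> / e"
      using e by (intro divide_right_mono) auto
    finally show ?thesis by simp
  qed
  have "\<bar>(\<integral>x. t x / K \<partial>\<mu>) - (\<integral>x. t x / K \<partial>\<nu>)\<bar> \<le> bl_dist UNIV dist \<mu> \<nu>"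
  proof (rule bl_dist_upper[where b = "1 / K" and c = "1 / e / K"])
    fix x y :: real
    show "\<bar>t x / K\<bar> \<le> 1 / K"
      using t01[of x] K by (simp add: divide_right_mono)
    have "\<bar>t x / K - t y / K\<bar> = \<bar>t x - t y\<bar> / K"
      using K by (simp add: diff_divide_distrib[symmetric])
    also have "\<dots> \<le> (1 / e) * \<bar>x - y\<bar> / K"
      using tlip K by (intro divide_right_mono) auto
    finally show "\<bar>t x / K - t y / K\<bar> \<le> 1 / e / K * dist x y"
      by (simp add: dist_real_def)
  next
    show "1 / K + 1 / e / K \<le> 1"
      using K by (simp only: add_divide_distrib[symmetric] K_def[symmetric]) simp
  qed (use assms sp K in auto)
  then have "\<bar>((\<integral>x. t x \<partial>\<mu>) - (\<integral>x. t x \<partial>\<nu>)) / K\<bar> \<le> bl_dist UNIV dist \<mu> \<nu>"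
    by (simp add: diff_divide_distrib)
  then have main: "\<bar>(\<integral>x. t x \<partial>\<mu>) - (\<integral>x. t x \<partial>\<nu>)\<bar> \<le> K * bl_dist UNIV dist \<mu> \<nu>"
    using K by (simp add: field_simps)
  have int: "integrable \<mu> t" "integrable \<nu> t"
    using t01 by (auto intro!: \<mu>.integrable_const_bound[where B = 1] \<nu>.integrable_const_bound[where B = 1])
  have "measure \<mu> {z. \<bar>z\<bar> \<le> a} = (\<integral>x. indicator {z. \<bar>z\<bar> \<le> a} x \<partial>\<mu>)"
    by (simp add: sp)
  also have "\<dots> \<le> (\<integral>x. t x \<partial>\<mu>)"
  proof (intro integral_mono int)
    show "integrable \<mu> (indicator {z. \<bar>z\<bar> \<le> a} :: real \<Rightarrow> real)"
      by (rule \<mu>.integrable_const_bound[where B = 1]) ((auto split: split_indicator)[1], measurable)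
    show "indicator {z. \<bar>z\<bar> \<le> a} x \<le> t x" for x
      using e by (auto simp: t_def indicator_def field_simps)
  qed
  also have "\<dots> \<le> (\<integral>x. t x \<partial>\<nu>) + K * bl_dist UNIV dist \<mu> \<nu>"
    using main by linarith
  also have "(\<integral>x. t x \<partial>\<nu>) \<le> (\<integral>x. indicator {z. \<bar>z\<bar> \<le> a + e} x \<partial>\<nu>)"
  proof (intro integral_mono int)
    show "integrable \<nu> (indicator {z. \<bar>z\<bar> \<le> a + e} :: real \<Rightarrow> real)"
      by (rule \<nu>.integrable_const_bound[where B = 1]) ((auto split: split_indicator)[1], measurable)
    show "t x \<le> indicator {z. \<bar>z\<bar> \<le> a + e} x" for x
      using e by (auto simp: t_def indicator_def field_simps min_def max_def)
  qed
  also have "(\<integral>x. indicator {z. \<bar>z\<bar> \<le> a + e} x \<partial>\<nu>) = measure \<nu> {z. \<bar>z\<bar> \<le> a + e}"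
    by (simp add: sp)
  finally show ?thesis by (simp add: K_def)
qed

subsection \<open>Convergence in probability\<close>

text \<open>Up to a null set, a large \<open>Z\<close> forces a large \<open>Y1\<close> or a large
  \<open>Y2\<close>, and outer measure is subadditive. Two controlling sequences are provided
  because the radius depends both on the distance of the laws and on the shift of the centre; where
  one suffices it is supplied twice.\<close>

lemma tends_to_0_in_prob_transfer:
  assumes Y: "tends_to_0_in_prob P Y1" "tends_to_0_in_prob P Y2"
    and Z: "\<And>e. e > 0 \<Longrightarrow> \<exists>\<eta>>0. \<forall>n\<ge>1. AE x in P n. \<bar>Y1 n x\<bar> \<le> \<eta> \<and> \<bar>Y2 n x\<bar> \<le> \<eta> \<longrightarrow> \<bar>Z n x\<bar> \<le> e"
  shows "tends_to_0_in_prob P Z"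
  unfolding tends_to_0_in_prob_def
proof (intro allI impI)
  fix e :: real assume "e > 0"
  from Z[OF this] obtain \<eta> where \<eta>: "\<eta> > 0"
    "\<And>n. n \<ge> 1 \<Longrightarrow> AE x in P n. \<bar>Y1 n x\<bar> \<le> \<eta> \<and> \<bar>Y2 n x\<bar> \<le> \<eta> \<longrightarrow> \<bar>Z n x\<bar> \<le> e" by blast
  let ?o = "\<lambda>Y n c. outer_measure_of (P n) {x \<in> space (P n). \<bar>Y n x\<bar> > c}"
  have le: "?o Z n e \<le> ?o Y1 n \<eta> + ?o Y2 n \<eta>" if n: "n \<ge> 1" for n
  proof -
    \<comment> \<open>The exceptional sets need not be measurable, so they are enlarged to
      measurable sets of the same outer measure, for which \<open>emeasure\<close> is
      subadditive.\<close>
    obtain E1 where E1: "E1 \<in> sets (P n)" "{x \<in> space (P n). \<bar>Y1 n x\<bar> > \<eta>} \<subseteq> E1" "?o Y1 n \<eta> = emeasure (P n) E1"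
      using outer_measure_of_attain[of "{x \<in> space (P n). \<bar>Y1 n x\<bar> > \<eta>}" "P n"] by auto
    obtain E2 where E2: "E2 \<in> sets (P n)" "{x \<in> space (P n). \<bar>Y2 n x\<bar> > \<eta>} \<subseteq> E2" "?o Y2 n \<eta> = emeasure (P n) E2"
      using outer_measure_of_attain[of "{x \<in> space (P n). \<bar>Y2 n x\<bar> > \<eta>}" "P n"] by auto
    obtain A where A: "{x \<in> space (P n). \<not> (\<bar>Y1 n x\<bar> \<le> \<eta> \<and> \<bar>Y2 n x\<bar> \<le> \<eta> \<longrightarrow> \<bar>Z n x\<bar> \<le> e)} \<subseteq> A"
      "emeasure (P n) A = 0" "A \<in> sets (P n)"
      by (rule AE_E[OF \<eta>(2)[OF n]])
    have "?o Z n e \<le> outer_measure_of (P n) (E1 \<union> E2 \<union> A)"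
      using E1 E2 A by (intro outer_measure_of_mono) fastforce
    also have "\<dots> = emeasure (P n) (E1 \<union> E2 \<union> A)"
      using E1 E2 A by (intro outer_measure_of_eq) auto
    also have "\<dots> \<le> emeasure (P n) (E1 \<union> E2) + emeasure (P n) A"
      using E1 E2 A by (intro emeasure_subadditive) auto
    also have "\<dots> \<le> emeasure (P n) E1 + emeasure (P n) E2"
      using E1 E2 A by (simp add: emeasure_subadditive)
    finally show ?thesis using E1 E2 by simp
  qed
  have "(\<lambda>n. ?o Y1 n \<eta> + ?o Y2 n \<eta>) \<longlonglongrightarrow> 0 + 0"
    using Y \<eta>(1) unfolding tends_to_0_in_prob_def by (intro tendsto_add) auto
  then have lim: "(\<lambda>n. ?o Y1 n \<eta> + ?o Y2 n \<eta>) \<longlonglongrightarrow> 0" by simp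
  show "(\<lambda>n. ?o Z n e) \<longlonglongrightarrow> 0"
    by (rule tendsto_sandwich[OF _ _ tendsto_const lim])
       (use le in \<open>auto simp: eventually_sequentially intro!: exI[of _ 1]\<close>)
qed

text \<open>For measurable variables the outer measure is the measure, and since the limit 0 is
  finite the passage from extended reals to reals is continuous there.\<close>

lemma tends_to_0_in_prob_measure:
  assumes "tends_to_0_in_prob P Y" "\<And>n. n \<ge> 1 \<Longrightarrow> Y n \<in> borel_measurable (P n)" "e > 0"
  shows "(\<lambda>n. measure (P n) {x \<in> space (P n). \<bar>Y n x\<bar> > e}) \<longlonglongrightarrow> 0"
proof -
  have "(\<lambda>n. enn2real (outer_measure_of (P n) {x \<in> space (P n). \<bar>Y n x\<bar> > e})) \<longlonglongrightarrow> enn2real 0"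
    using assms by (intro tendsto_enn2real) (auto simp: tends_to_0_in_prob_def)
  moreover have "\<forall>\<^sub>F n in sequentially. enn2real (outer_measure_of (P n) {x \<in> space (P n). \<bar>Y n x\<bar> > e})
      = measure (P n) {x \<in> space (P n). \<bar>Y n x\<bar> > e}"
    unfolding eventually_sequentially
  proof (intro exI[of _ 1] allI impI)
    fix n :: nat assume "n \<ge> 1"
    note [measurable] = assms(2)[OF this]
    have "{x \<in> space (P n). \<bar>Y n x\<bar> > e} \<in> sets (P n)" by measurable
    then show "enn2real (outer_measure_of (P n) {x \<in> space (P n). \<bar>Y n x\<bar> > e})
      = measure (P n) {x \<in> space (P n). \<bar>Y n x\<bar> > e}"
      by (simp add: measure_def)
  qed
  ultimately show ?thesis
    by (simp add: filterlim_cong)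
qed

lemma (in prob_space) ex_measure_abs_gt_le:
  fixes X :: "'a \<Rightarrow> real"
  assumes [measurable]: "X \<in> borel_measurable M" and "e > 0"
  shows "\<exists>K. measure M {x \<in> space M. \<bar>X x\<bar> > K} \<le> e"
proof -
  have "(\<lambda>i. measure M {x \<in> space M. \<bar>X x\<bar> > real i}) \<longlonglongrightarrow> measure M (\<Inter>i. {x \<in> space M. \<bar>X x\<bar> > real i})"
    by (rule finite_Lim_measure_decseq) (auto simp: decseq_def)
  also have "(\<Inter>i. {x \<in> space M. \<bar>X x\<bar> > real i}) = {}"
  proof -
    have "\<exists>i. \<not> \<bar>X x\<bar> > real i" for x
      using reals_Archimedean2[of "\<bar>X x\<bar>"] by (auto simp: not_less intro: less_imp_le)
    then show ?thesis by blast
  qed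
  finally have "\<forall>\<^sub>F i in sequentially. measure M {x \<in> space M. \<bar>X x\<bar> > real i} < e"
    using assms(2) by (intro order_tendstoD) auto
  then show ?thesis
    by (auto simp: eventually_sequentially intro: less_imp_le)
qed

text \<open>Convergence controls only the indices from some \<open>n0\<close> on. Each of the
  finitely many earlier variables is tight by itself, and the largest of all these bounds serves for
  every \<open>n\<close>.\<close>

lemma bounded_in_prob_if_tends:
  assumes "\<And>n. n \<ge> 1 \<Longrightarrow> prob_space (P n)" "\<And>n. n \<ge> 1 \<Longrightarrow> R n \<in> borel_measurable (P n)"
    and "tends_to_0_in_prob P (\<lambda>n x. R n x - q)"
  shows "bounded_in_prob P R"
  unfolding bounded_in_prob_def
proof (intro allI impI)
  fix e :: real assume e: "e > 0"
  have "(\<lambda>n. measure (P n) {x \<in> space (P n). \<bar>R n x - q\<bar> > 1}) \<longlonglongrightarrow> 0"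
    using assms by (intro tends_to_0_in_prob_measure) auto
  then have "\<forall>\<^sub>F n in sequentially. measure (P n) {x \<in> space (P n). \<bar>R n x - q\<bar> > 1} < e"
    using e by (rule order_tendstoD)
  then obtain n0 where n0: "\<And>n. n \<ge> n0 \<Longrightarrow> measure (P n) {x \<in> space (P n). \<bar>R n x - q\<bar> > 1} < e"
    by (auto simp: eventually_sequentially)
  have "\<forall>n. \<exists>K. n \<ge> 1 \<longrightarrow> measure (P n) {x \<in> space (P n). \<bar>R n x\<bar> > K} \<le> e"
    using prob_space.ex_measure_abs_gt_le[OF assms(1,2) e] by blast
  then obtain K where K: "\<And>n. n \<ge> 1 \<Longrightarrow> measure (P n) {x \<in> space (P n). \<bar>R n x\<bar> > K n} \<le> e"
    by metis
  define K' where "K' = Max (insert (\<bar>q\<bar> + 1) (K ` {..<n0}))"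
  have "measure (P n) {x \<in> space (P n). \<bar>R n x\<bar> > K'} \<le> e" if n: "n \<ge> 1" for n
  proof -
    interpret prob_space "P n" using assms(1) n .
    note [measurable] = assms(2)[OF n]
    have q: "\<bar>q\<bar> + 1 \<le> K'" unfolding K'_def by (intro Max_ge) auto
    show ?thesis
    proof (cases "n < n0")
      case True
      then have "K n \<le> K'" unfolding K'_def by (intro Max_ge) auto
      then have "measure (P n) {x \<in> space (P n). \<bar>R n x\<bar> > K'} \<le> measure (P n) {x \<in> space (P n). \<bar>R n x\<bar> > K n}"
        by (intro finite_measure_mono) auto
      with K[OF n] show ?thesis by linarith
    next
      case False
      have "measure (P n) {x \<in> space (P n). \<bar>R n x\<bar> > K'} \<le> measure (P n) {x \<in> space (P n). \<bar>R n x - q\<bar> > 1}"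
        using q by (intro finite_measure_mono) auto
      with n0[of n] False show ?thesis by linarith
    qed
  qed
  then show "\<exists>K. \<forall>n\<ge>1. measure (P n) {x \<in> space (P n). \<bar>R n x\<bar> > K} \<le> e" by blast
qed

subsection \<open>Credible intervals under a centred normal limit\<close>

lemma real_distribution_normal:
  "0 < \<sigma> \<Longrightarrow> real_distribution (density lborel (normal_density 0 \<sigma>))"
  by (auto simp: real_distribution_def real_distribution_axioms_def prob_space_normal_density)

text \<open>Absence of atoms gives continuity of the distribution function and makes the endpoints
  of intervals immaterial.\<close>

lemma measure_normal_singleton: "measure (density lborel (normal_density 0 \<sigma>)) {a} = 0"
proof -
  have "emeasure (density lborel (normal_density 0 \<sigma>)) {a} = 0"
    by (subst emeasure_density) (auto intro!: nn_integral_0_iff_AE[THEN iffD2] AE_I'[of "{a}"] simp: indicator_def)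
  then show ?thesis by (simp add: measure_def)
qed

text \<open>For \<open>r \<ge> 0\<close> this is the mass of \<open>[-r, r]\<close>. Written with
  distribution functions it is odd in \<open>r\<close>, hence strictly increasing on the whole line,
  whereas the mass itself is constantly 0 for negative \<open>r\<close>.\<close>

definition normal_central :: "real \<Rightarrow> real \<Rightarrow> real" where
  "normal_central \<sigma> r = cdf (density lborel (normal_density 0 \<sigma>)) r - cdf (density lborel (normal_density 0 \<sigma>)) (- r)"

context
  fixes \<sigma> :: real
  assumes \<sigma>: "0 < \<sigma>"
begin

interpretation real_distribution "density lborel (normal_density 0 \<sigma>)"
  by (rule real_distribution_normal[OF \<sigma>])

text \<open>The density is positive everywhere, so an interval without mass would be a Lebesgue null
  set.\<close>

lemma cdf_normal_strict_mono: "x < y \<Longrightarrow> cdf (density lborel (normal_density 0 \<sigma>)) x < cdf (density lborel (normal_density 0 \<sigma>)) y"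
proof -
  assume xy: "x < y"
  have "emeasure (density lborel (normal_density 0 \<sigma>)) {x<..y} \<noteq> 0"
  proof
    assume "emeasure (density lborel (normal_density 0 \<sigma>)) {x<..y} = 0"
    then have "AE z in lborel. ennreal (normal_density 0 \<sigma> z) * indicator {x<..y} z = 0"
      by (subst (asm) emeasure_density) (auto simp: nn_integral_0_iff_AE)
    then have "AE z in lborel. z \<notin> {x<..y}"
    proof eventually_elim
      case (elim z)
      with normal_density_pos[OF \<sigma>, of 0 z] show ?case by (auto simp: indicator_def split: if_splits)
    qed
    moreover have "{z \<in> space lborel. \<not> z \<notin> {x<..y}} = {x<..y}" by auto
    ultimately have "emeasure lborel {x<..y} = 0"
      using AE_iff_measurable[of "{x<..y}" lborel "\<lambda>z. z \<notin> {x<..y}"] by simp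
    with xy show False by simp
  qed
  then have "measure (density lborel (normal_density 0 \<sigma>)) {x<..y} > 0"
    by (simp add: emeasure_eq_measure measure_le_0_iff zero_less_measure_iff)
  with cdf_diff_eq[OF xy] show ?thesis by linarith
qed

lemma normal_central_strict_mono: "x < y \<Longrightarrow> normal_central \<sigma> x < normal_central \<sigma> y"
  using cdf_normal_strict_mono[of x y] cdf_normal_strict_mono[of "- y" "- x"]
  by (simp add: normal_central_def)

lemma isCont_normal_central: "isCont (normal_central \<sigma>) x"
proof -
  have c: "isCont (cdf (density lborel (normal_density 0 \<sigma>))) y" for y
    by (simp add: isCont_cdf measure_normal_singleton)
  have "isCont (\<lambda>r. cdf (density lborel (normal_density 0 \<sigma>)) (- r)) x"
    by (rule isCont_o2[OF _ c]) (intro continuous_intros)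
  then show ?thesis
    unfolding normal_central_def[abs_def] using c by (intro continuous_intros)
qed

text \<open>The maximum with 0 accounts for the empty set when \<open>r < 0\<close>. For
  \<open>r > 0\<close> the distribution functions measure the half-open interval, and the missing
  endpoint carries no mass.\<close>

lemma measure_normal_abs_le:
  "measure (density lborel (normal_density 0 \<sigma>)) {z. \<bar>z\<bar> \<le> r} = max 0 (normal_central \<sigma> r)"
proof -
  let ?\<nu> = "density lborel (normal_density 0 \<sigma>)"
  have *: "measure ?\<nu> {z. \<bar>z\<bar> \<le> r} = normal_central \<sigma> r" if "r > 0" for r
  proof -
    have "{z. \<bar>z\<bar> \<le> r} = {- r<..r} \<union> {- r}" using that by auto
    then have "measure ?\<nu> {z. \<bar>z\<bar> \<le> r} = measure ?\<nu> {- r<..r} + measure ?\<nu> {- r}"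
      by (simp only:) (rule finite_measure_Union, auto)
    then show ?thesis
      using cdf_diff_eq[of "- r" r] that by (simp add: measure_normal_singleton normal_central_def)
  qed
  have 0: "normal_central \<sigma> 0 = 0" by (simp add: normal_central_def)
  consider "r < 0" | "r = 0" | "r > 0" by linarith
  then show ?thesis
  proof cases
    case 1
    then have "{z. \<bar>z\<bar> \<le> r} = {}" by auto
    with normal_central_strict_mono[OF 1] 0 show ?thesis by simp
  next
    case 2
    then have "{z. \<bar>z\<bar> \<le> r} = {0}" by auto
    with 2 0 show ?thesis by (simp add: measure_normal_singleton)
  next
    case 3
    with normal_central_strict_mono[OF 3] 0 * show ?thesis by simp
  qed
qed

lemma ex_normal_central_eq:
  assumes "0 < p" "p < 1"
  obtains q where "0 < q" "normal_central \<sigma> q = p"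
proof -
  let ?F = "cdf (density lborel (normal_density 0 \<sigma>))"
  have "(\<lambda>i. ?F (real i) - ?F (- real i)) \<longlonglongrightarrow> 1 - 0"
    by (intro tendsto_diff cdf_lim_infty_prob cdf_lim_neg_infty)
  then have "\<forall>\<^sub>F i in sequentially. normal_central \<sigma> (real i) > p"
    unfolding normal_central_def using assms by (intro order_tendstoD) auto
  then obtain i where i: "normal_central \<sigma> (real i) > p"
    by (auto simp: eventually_sequentially)
  have 0: "normal_central \<sigma> 0 = 0" by (simp add: normal_central_def)
  obtain q where q: "0 \<le> q" "normal_central \<sigma> q = p"
    using IVT[of "normal_central \<sigma>" 0 p "real i"] isCont_normal_central i 0 assms by auto
  with 0 assms have "q \<noteq> 0" by auto
  with q show ?thesis by (intro that) auto
qed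

text \<open>Strict monotonicity of the normal mass leaves a gap between the mass at radius
  \<open>q\<close> and at radii away from \<open>q\<close>; a law and a centre close enough cannot
  bridge it. One \<eta> serves all \<mu>, \<open>d\<close> and \<open>r\<close>, so the bound can be
  applied separately at each observation.\<close>

lemma credible_radius_close:
  assumes q: "0 < q" and \<epsilon>: "0 < \<epsilon>"
  shows "\<exists>\<eta>>0. \<forall>\<mu> d r. prob_space \<mu> \<longrightarrow> sets \<mu> = sets borel \<longrightarrow>
    bl_dist UNIV dist \<mu> (density lborel (normal_density 0 \<sigma>)) \<le> \<eta> \<longrightarrow> \<bar>d\<bar> \<le> \<eta> \<longrightarrow>
    measure \<mu> {z. \<bar>z - d\<bar> \<le> r} = normal_central \<sigma> q \<longrightarrow> \<bar>r - q\<bar> \<le> \<epsilon>"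
proof -
  let ?\<nu> = "density lborel (normal_density 0 \<sigma>)"
  let ?G = "normal_central \<sigma>"
  \<comment> \<open>A deviation of \<open>4 * e\<close> is budgeted as follows: \<open>e\<close> for
    the shifted centre \<open>d\<close>, \<open>e\<close> for the ramp of the trapezoid, and
    \<open>2 * e\<close> to create the gap in normal mass.\<close>
  define e where "e = \<epsilon> / 4"
  have e: "e > 0" using \<epsilon> by (simp add: e_def)
  define K where "K = 1 + 1 / e"
  have K: "K > 0" using e by (simp add: K_def add_pos_pos)
  have Gq: "?G q > 0" using normal_central_strict_mono[OF q] by (simp add: normal_central_def)
  \<comment> \<open>The second entry compares with \<open>max 0\<close> because
    \<open>q - 2 * e\<close> may be negative, in which case the actual mass is 0.\<close>
  define gap where "gap = min (?G (q + 2 * e) - ?G q) (?G q - max 0 (?G (q - 2 * e)))"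
  have gap: "gap > 0"
    using normal_central_strict_mono[of q "q + 2 * e"] normal_central_strict_mono[of "q - 2 * e" q] e Gq
    by (auto simp: gap_def)
  \<comment> \<open>The first entry keeps the shift of the centre within its budget; the second
    keeps the cost \<open>K * \<eta>\<close> of the trapezoid comparison at no more than half of
    \<open>gap\<close>.\<close>
  define \<eta> where "\<eta> = min e (gap / (2 * K))"
  have \<eta>: "\<eta> > 0" "\<eta> \<le> e" using e gap K by (auto simp: \<eta>_def)
  have "K * \<eta> \<le> K * (gap / (2 * K))"
    using K by (intro mult_left_mono) (auto simp: \<eta>_def)
  then have K\<eta>: "K * \<eta> < gap" using K gap by simp
  have "\<bar>r - q\<bar> \<le> \<epsilon>" if \<mu>: "prob_space \<mu>" and s [measurable_cong]: "sets \<mu> = sets borel"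
    and bl: "bl_dist UNIV dist \<mu> ?\<nu> \<le> \<eta>" and d: "\<bar>d\<bar> \<le> \<eta>"
    and r: "measure \<mu> {z. \<bar>z - d\<bar> \<le> r} = ?G q" for \<mu> d r
  proof (rule ccontr)
    interpret \<mu>: prob_space \<mu> by fact
    have "K * bl_dist UNIV dist \<mu> ?\<nu> \<le> K * \<eta>"
      using bl K by (intro mult_left_mono) auto
    then have Kbl: "K * bl_dist UNIV dist \<mu> ?\<nu> < gap"
      using K\<eta> by linarith
    then have Kbl': "K * bl_dist UNIV dist ?\<nu> \<mu> < gap"
      by (simp only: bl_dist_commute[of UNIV dist ?\<nu> \<mu>])
    assume "\<not> \<bar>r - q\<bar> \<le> \<epsilon>"
    then consider "r > q + 4 * e" | "r < q - 4 * e" by (force simp: e_def)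
    then show False
    proof cases
      case 1
      have "measure ?\<nu> {z. \<bar>z\<bar> \<le> q + 2 * e} \<le> measure \<mu> {z. \<bar>z\<bar> \<le> q + 2 * e + e} + K * bl_dist UNIV dist ?\<nu> \<mu>"
        unfolding K_def by (intro measure_abs_le_bl_dist \<mu> s e) (simp_all add: prob_space_axioms)
      also have "measure \<mu> {z. \<bar>z\<bar> \<le> q + 2 * e + e} \<le> measure \<mu> {z. \<bar>z - d\<bar> \<le> r}"
        using 1 d \<eta> by (intro \<mu>.finite_measure_mono) auto
      finally have "?G (q + 2 * e) < ?G q + gap"
        using Kbl' r by (simp add: measure_normal_abs_le)
      then show False by (simp add: gap_def)
    next
      case 2
      have "measure \<mu> {z. \<bar>z - d\<bar> \<le> r} \<le> measure \<mu> {z. \<bar>z\<bar> \<le> q - 3 * e}"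
        using 2 d \<eta> by (intro \<mu>.finite_measure_mono) auto
      also have "\<dots> \<le> measure ?\<nu> {z. \<bar>z\<bar> \<le> q - 3 * e + e} + K * bl_dist UNIV dist \<mu> ?\<nu>"
        unfolding K_def by (intro measure_abs_le_bl_dist \<mu> s e) (simp_all add: prob_space_axioms)
      also have "q - 3 * e + e = q - 2 * e" by simp
      finally have "?G q < max 0 (?G (q - 2 * e)) + gap"
        using Kbl r by (simp only: measure_normal_abs_le)
      then show False by (simp add: gap_def)
    qed
  qed
  with \<eta>(1) show ?thesis by blast
qed

lemma credible_radius_tends:
  assumes q: "0 < q"
    and \<mu>: "\<And>n x. n \<ge> 1 \<Longrightarrow> x \<in> space (P n) \<Longrightarrow> prob_space (\<mu> n x)"
      "\<And>n x. n \<ge> 1 \<Longrightarrow> x \<in> space (P n) \<Longrightarrow> sets (\<mu> n x) = sets borel"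
    and bl: "tends_to_0_in_prob P (\<lambda>n x. bl_dist UNIV dist (\<mu> n x) (density lborel (normal_density 0 \<sigma>)))"
    and D: "tends_to_0_in_prob P D"
    and R: "\<And>n. n \<ge> 1 \<Longrightarrow> AE x in P n. measure (\<mu> n x) {z. \<bar>z - D n x\<bar> \<le> R n x} = normal_central \<sigma> q"
  shows "tends_to_0_in_prob P (\<lambda>n x. R n x - q)"
proof (rule tends_to_0_in_prob_transfer[OF bl D])
  fix e :: real assume "e > 0"
  from credible_radius_close[OF q this] obtain \<eta> where \<eta>: "\<eta> > 0"
    "\<And>\<mu> d r. prob_space \<mu> \<Longrightarrow> sets \<mu> = sets borel \<Longrightarrow>
    bl_dist UNIV dist \<mu> (density lborel (normal_density 0 \<sigma>)) \<le> \<eta> \<Longrightarrow> \<bar>d\<bar> \<le> \<eta> \<Longrightarrow>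
    measure \<mu> {z. \<bar>z - d\<bar> \<le> r} = normal_central \<sigma> q \<Longrightarrow> \<bar>r - q\<bar> \<le> e" by blast
  have "AE x in P n. \<bar>bl_dist UNIV dist (\<mu> n x) (density lborel (normal_density 0 \<sigma>))\<bar> \<le> \<eta> \<and>
      \<bar>D n x\<bar> \<le> \<eta> \<longrightarrow> \<bar>R n x - q\<bar> \<le> e" if n: "n \<ge> 1" for n
    using R[OF n] AE_space
  proof eventually_elim
    case (elim x)
    then show ?case
      using \<eta>(2)[OF \<mu>(1)[OF n elim(2)] \<mu>(2)[OF n elim(2)]] abs_le_D1 by blast
  qed
  with \<eta>(1) show "\<exists>\<eta>>0. \<forall>n\<ge>1. AE x in P n. \<bar>bl_dist UNIV dist (\<mu> n x) (density lborel (normal_density 0 \<sigma>))\<bar> \<le> \<eta> \<and>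
      \<bar>D n x\<bar> \<le> \<eta> \<longrightarrow> \<bar>R n x - q\<bar> \<le> e" by blast
qed

text \<open>The law of \<open>Z n\<close> is exactly normal for each \<open>n\<close>, so only
  \<open>D n\<close> and \<open>R n\<close> perturb the event. Outside a set of small probability it
  lies between the events \<open>\<bar>Z n x\<bar> \<le> q - 2 * \<eta>\<close> and
  \<open>\<bar>Z n x\<bar> \<le> q + 2 * \<eta>\<close>, one \<eta> coming from each
  perturbation.\<close>

lemma coverage_limit:
  assumes q: "0 < q" and P: "\<And>n. n \<ge> 1 \<Longrightarrow> prob_space (P n)"
    and Z: "\<And>n. n \<ge> 1 \<Longrightarrow> Z n \<in> borel_measurable (P n)"
      "\<And>n. n \<ge> 1 \<Longrightarrow> distr (P n) borel (Z n) = density lborel (normal_density 0 \<sigma>)"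
    and D: "\<And>n. n \<ge> 1 \<Longrightarrow> D n \<in> borel_measurable (P n)" "tends_to_0_in_prob P D"
    and R: "\<And>n. n \<ge> 1 \<Longrightarrow> R n \<in> borel_measurable (P n)" "tends_to_0_in_prob P (\<lambda>n x. R n x - q)"
  shows "(\<lambda>n. measure (P n) {x \<in> space (P n). \<bar>Z n x + D n x\<bar> \<le> R n x}) \<longlonglongrightarrow> normal_central \<sigma> q"
proof (rule LIMSEQ_I)
  fix \<epsilon> :: real assume \<epsilon>: "\<epsilon> > 0"
  let ?G = "normal_central \<sigma>"
  have pos: "?G r > 0" if "r > 0" for r
    using normal_central_strict_mono[OF that] by (simp add: normal_central_def)
  from isCont_normal_central[of q] \<epsilon> obtain \<delta> where \<delta>: "\<delta> > 0"
    "\<And>r. \<bar>r - q\<bar> < \<delta> \<Longrightarrow> \<bar>?G r - ?G q\<bar> < \<epsilon> / 2"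
    unfolding continuous_at_eps_delta dist_real_def by (meson half_gt_zero)
  \<comment> \<open>With a third of the minimum, both \<open>q - 2 * \<eta>\<close> and
    \<open>q + 2 * \<eta>\<close> lie within the continuity radius \<delta> of \<open>q\<close>, and
    the smaller one stays positive.\<close>
  define \<eta> where "\<eta> = min \<delta> q / 3"
  have \<eta>: "\<eta> > 0" "2 * \<eta> < \<delta>" "2 * \<eta> < q" using \<delta>(1) q by (auto simp: \<eta>_def min_def)
  define bad where "bad n = {x \<in> space (P n). \<bar>D n x\<bar> > \<eta>} \<union> {x \<in> space (P n). \<bar>R n x - q\<bar> > \<eta>}" for n
  have "(\<lambda>n. measure (P n) {x \<in> space (P n). \<bar>D n x\<bar> > \<eta>} + measure (P n) {x \<in> space (P n). \<bar>R n x - q\<bar> > \<eta>}) \<longlonglongrightarrow> 0 + 0"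
    using D R \<eta>(1) by (intro tendsto_add tends_to_0_in_prob_measure) auto
  then have "\<forall>\<^sub>F n in sequentially. measure (P n) {x \<in> space (P n). \<bar>D n x\<bar> > \<eta>} + measure (P n) {x \<in> space (P n). \<bar>R n x - q\<bar> > \<eta>} < \<epsilon> / 2"
    using \<epsilon> by (intro order_tendstoD) auto
  then obtain n0 where n0: "\<And>n. n \<ge> n0 \<Longrightarrow> measure (P n) {x \<in> space (P n). \<bar>D n x\<bar> > \<eta>} + measure (P n) {x \<in> space (P n). \<bar>R n x - q\<bar> > \<eta>} < \<epsilon> / 2"
    by (auto simp: eventually_sequentially)
  have "norm (measure (P n) {x \<in> space (P n). \<bar>Z n x + D n x\<bar> \<le> R n x} - ?G q) < \<epsilon>" if n: "n \<ge> max 1 n0" for n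
  proof -
    have n1: "n \<ge> 1" and nn0: "n \<ge> n0" using n by auto
    interpret P: prob_space "P n" using P n1 .
    note [measurable] = Z(1)[OF n1] D(1)[OF n1] R(1)[OF n1]
    have bad [measurable]: "bad n \<in> sets (P n)" unfolding bad_def by measurable
    have "measure (P n) (bad n) \<le> measure (P n) {x \<in> space (P n). \<bar>D n x\<bar> > \<eta>} + measure (P n) {x \<in> space (P n). \<bar>R n x - q\<bar> > \<eta>}"
      unfolding bad_def by (intro measure_Un_le) measurable
    with n0[OF nn0] have b: "measure (P n) (bad n) < \<epsilon> / 2" by linarith
    have ZG: "measure (P n) {x \<in> space (P n). \<bar>Z n x\<bar> \<le> r} = ?G r" if "r > 0" for r
    proof -
      have "measure (distr (P n) borel (Z n)) {z. \<bar>z\<bar> \<le> r} = measure (P n) (Z n -` {z. \<bar>z\<bar> \<le> r} \<inter> space (P n))"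
        by (intro measure_distr) measurable
      also have "Z n -` {z. \<bar>z\<bar> \<le> r} \<inter> space (P n) = {x \<in> space (P n). \<bar>Z n x\<bar> \<le> r}" by auto
      finally show ?thesis
        using Z(2)[OF n1] pos[OF that] by (simp add: measure_normal_abs_le)
    qed
    let ?C = "{x \<in> space (P n). \<bar>Z n x + D n x\<bar> \<le> R n x}"
    have "measure (P n) ?C \<le> measure (P n) ({x \<in> space (P n). \<bar>Z n x\<bar> \<le> q + 2 * \<eta>} \<union> bad n)"
      by (intro P.finite_measure_mono) (auto simp: bad_def)
    also have "\<dots> \<le> measure (P n) {x \<in> space (P n). \<bar>Z n x\<bar> \<le> q + 2 * \<eta>} + measure (P n) (bad n)"
      by (intro measure_Un_le) measurable
    finally have up: "measure (P n) ?C < ?G (q + 2 * \<eta>) + \<epsilon> / 2"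
      using b ZG[of "q + 2 * \<eta>"] q \<eta> by simp
    have "measure (P n) {x \<in> space (P n). \<bar>Z n x\<bar> \<le> q - 2 * \<eta>} \<le> measure (P n) (?C \<union> bad n)"
      by (intro P.finite_measure_mono) (auto simp: bad_def)
    also have "\<dots> \<le> measure (P n) ?C + measure (P n) (bad n)"
      by (intro measure_Un_le) measurable
    finally have lo: "?G (q - 2 * \<eta>) - \<epsilon> / 2 < measure (P n) ?C"
      using b ZG[of "q - 2 * \<eta>"] \<eta> by simp
    have "\<bar>?G (q + 2 * \<eta>) - ?G q\<bar> < \<epsilon> / 2" "\<bar>?G (q - 2 * \<eta>) - ?G q\<bar> < \<epsilon> / 2"
      using \<eta> by (auto intro!: \<delta>(2) simp del: divide_less_eq_numeral1 less_divide_eq_numeral1)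
    with up lo show ?thesis by (simp only: real_norm_def)
  qed
  then show "\<exists>no. \<forall>n\<ge>no. norm (measure (P n) {x \<in> space (P n). \<bar>Z n x + D n x\<bar> \<le> R n x} - ?G q) < \<epsilon>"
    by blast
qed

end

subsection \<open>Parseval's identity\<close>

lemma L2_measurable: "f \<in> L2 \<Longrightarrow> f \<in> borel_measurable lebI"
  by (simp add: L2_def)

lemma L2_mult_integrable:
  assumes "f \<in> L2" "g \<in> L2"
  shows "integrable lebI (\<lambda>x. f x * g x)"
proof (rule Bochner_Integration.integrable_bound)
  show "integrable lebI (\<lambda>x. (f x)\<^sup>2 + (g x)\<^sup>2)"
    using assms by (simp add: L2_def)
  show "(\<lambda>x. f x * g x) \<in> borel_measurable lebI"
    using assms[THEN L2_measurable] by measurable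
  have "\<bar>f x * g x\<bar> \<le> (f x)\<^sup>2 + (g x)\<^sup>2" for x
  proof -
    have "0 \<le> \<bar>f x\<bar> * \<bar>g x\<bar>" by simp
    with sum_squares_bound[of "\<bar>f x\<bar>" "\<bar>g x\<bar>"] show ?thesis
      unfolding abs_mult power2_abs by linarith
  qed
  then show "AE x in lebI. norm (f x * g x) \<le> norm ((f x)\<^sup>2 + (g x)\<^sup>2)"
    by (intro AE_I2) (simp add: abs_of_nonneg)
qed

lemma L2_zero: "(\<lambda>x. 0) \<in> L2"
  by (simp add: L2_def)

lemma L2_add:
  assumes "f \<in> L2" "g \<in> L2"
  shows "(\<lambda>x. f x + g x) \<in> L2"
proof -
  have "(\<lambda>x. f x + g x) \<in> borel_measurable lebI"
    using assms[THEN L2_measurable] by measurable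
  moreover have "integrable lebI (\<lambda>x. (f x)\<^sup>2 + (2 * (f x * g x) + (g x)\<^sup>2))"
    using assms L2_mult_integrable[OF assms] by (auto simp: L2_def)
  moreover have "(\<lambda>x. (f x + g x)\<^sup>2) = (\<lambda>x. (f x)\<^sup>2 + (2 * (f x * g x) + (g x)\<^sup>2))"
    by (auto simp: power2_eq_square algebra_simps)
  ultimately show ?thesis by (simp add: L2_def)
qed

lemma L2_scale: "f \<in> L2 \<Longrightarrow> (\<lambda>x. c * f x) \<in> L2"
  by (auto simp: L2_def power_mult_distrib)

lemma L2_diff: "f \<in> L2 \<Longrightarrow> g \<in> L2 \<Longrightarrow> (\<lambda>x. f x - g x) \<in> L2"
  using L2_add[of f "\<lambda>x. - 1 * g x"] L2_scale[of g "- 1"] by simp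

lemma L2_sum: "(\<And>i. i \<in> F \<Longrightarrow> h i \<in> L2) \<Longrightarrow> (\<lambda>x. \<Sum>i\<in>F. h i x) \<in> L2"
  by (induction F rule: infinite_finite_induct) (auto simp: L2_zero intro: L2_add)

lemma L2_inner_commute: "L2_inner f g = L2_inner g f"
  by (simp add: L2_inner_def mult.commute)

lemma L2_inner_add_left:
  "f \<in> L2 \<Longrightarrow> g \<in> L2 \<Longrightarrow> h \<in> L2 \<Longrightarrow> L2_inner (\<lambda>x. f x + g x) h = L2_inner f h + L2_inner g h"
  by (simp add: L2_inner_def distrib_right L2_mult_integrable)

lemma L2_inner_scale_left: "L2_inner (\<lambda>x. c * f x) h = c * L2_inner f h"
  by (simp add: L2_inner_def mult.assoc)

lemma L2_inner_diff_left:
  "f \<in> L2 \<Longrightarrow> g \<in> L2 \<Longrightarrow> h \<in> L2 \<Longrightarrow> L2_inner (\<lambda>x. f x - g x) h = L2_inner f h - L2_inner g h"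
  by (simp add: L2_inner_def left_diff_distrib L2_mult_integrable)

lemma L2_inner_sum_left:
  "(\<And>i. i \<in> F \<Longrightarrow> u i \<in> L2) \<Longrightarrow> h \<in> L2 \<Longrightarrow> L2_inner (\<lambda>x. \<Sum>i\<in>F. u i x) h = (\<Sum>i\<in>F. L2_inner (u i) h)"
  by (simp add: L2_inner_def sum_distrib_right L2_mult_integrable)

lemma L2_inner_self_nonneg: "0 \<le> L2_inner f f"
  by (simp add: L2_inner_def)

lemma L2_norm_square: "(L2_norm f)\<^sup>2 = L2_inner f f"
  by (simp add: L2_norm_def L2_inner_self_nonneg)

abbreviation basis_fun :: "basis \<Rightarrow> int \<times> int \<Rightarrow> real \<Rightarrow> real" where
  "basis_fun B i \<equiv> psi B (fst i) (snd i)"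

lemma coef_eq: "coef B f i = (if i \<in> indices B then L2_inner f (basis_fun B i) else 0)"
  by (simp add: coef_def split_beta)

locale L2_basis =
  fixes B :: basis
  assumes onb: "orthonormal_basis B"
begin

lemma basis_fun_L2: "i \<in> indices B \<Longrightarrow> basis_fun B i \<in> L2"
  using onb by (auto simp: orthonormal_basis_def)

lemma basis_fun_orthonormal:
  assumes "i \<in> indices B" "j \<in> indices B"
  shows "L2_inner (basis_fun B i) (basis_fun B j) = (if i = j then 1 else 0)"
proof -
  have "\<forall>i\<in>indices B. \<forall>j\<in>indices B. L2_inner (basis_fun B i) (basis_fun B j) = (if i = j then 1 else 0)"
    using onb unfolding orthonormal_basis_def split_beta prod.collapse by (elim conjE) assumption
  with assms show ?thesis by blast
qed

lemma basis_sum_L2: "F \<subseteq> indices B \<Longrightarrow> (\<lambda>x. \<Sum>i\<in>F. c i * basis_fun B i x) \<in> L2"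
  by (intro L2_sum L2_scale basis_fun_L2) auto

lemma basis_dense:
  assumes "f \<in> L2" "e > 0"
  obtains F c where "finite F" "F \<subseteq> indices B" "L2_dist f (\<lambda>x. \<Sum>i\<in>F. c i * basis_fun B i x) < e"
proof -
  have "\<forall>f\<in>L2. \<forall>e>0. \<exists>F c. finite F \<and> F \<subseteq> indices B \<and>
      L2_dist f (\<lambda>x. \<Sum>i\<in>F. c i * basis_fun B i x) < e"
    using onb unfolding orthonormal_basis_def split_beta prod.collapse by (elim conjE) assumption
  with assms have "\<exists>F c. finite F \<and> F \<subseteq> indices B \<and> L2_dist f (\<lambda>x. \<Sum>i\<in>F. c i * basis_fun B i x) < e"
    by blast
  then show ?thesis by (elim exE conjE) (rule that)
qed

lemma inner_basis_sum:
  assumes "finite F" "F \<subseteq> indices B" "i \<in> indices B"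
  shows "L2_inner (\<lambda>x. \<Sum>j\<in>F. c j * basis_fun B j x) (basis_fun B i) = (if i \<in> F then c i else 0)"
proof -
  have "L2_inner (\<lambda>x. \<Sum>j\<in>F. c j * basis_fun B j x) (basis_fun B i) = (\<Sum>j\<in>F. c j * L2_inner (basis_fun B j) (basis_fun B i))"
    using assms by (subst L2_inner_sum_left) (auto intro!: L2_scale basis_fun_L2 simp: L2_inner_scale_left)
  also have "\<dots> = (\<Sum>j\<in>F. if i = j then c j else 0)"
  proof (intro sum.cong refl)
    fix j assume "j \<in> F"
    with assms(2) have "j \<in> indices B" by blast
    from basis_fun_orthonormal[OF this assms(3)]
    show "c j * L2_inner (basis_fun B j) (basis_fun B i) = (if i = j then c j else 0)" by simp
  qed
  finally show ?thesis using assms by simp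
qed

text \<open>Pythagoras with arbitrary coefficients. Taking \<open>c = coef B f\<close> yields
  Bessel's inequality; nonnegativity of the last sum says that no other choice approximates
  better.\<close>

lemma norm_diff_basis_sum:
  fixes c :: form
  assumes f: "f \<in> L2" and F: "finite F" "F \<subseteq> indices B"
  defines "p \<equiv> \<lambda>x. \<Sum>i\<in>F. c i * basis_fun B i x"
  shows "L2_inner (\<lambda>x. f x - p x) (\<lambda>x. f x - p x) =
    L2_inner f f - (\<Sum>i\<in>F. (coef B f i)\<^sup>2) + (\<Sum>i\<in>F. (c i - coef B f i)\<^sup>2)"
proof -
  have p: "p \<in> L2" unfolding p_def by (rule basis_sum_L2[OF F(2)])
  have inner_p: "L2_inner p h = (\<Sum>i\<in>F. c i * L2_inner (basis_fun B i) h)" if "h \<in> L2" for h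
    unfolding p_def using F that
    by (subst L2_inner_sum_left) (auto intro!: L2_scale basis_fun_L2 simp: L2_inner_scale_left)
  have pf: "L2_inner p f = (\<Sum>i\<in>F. c i * coef B f i)"
    unfolding inner_p[OF f] using F
    by (intro sum.cong) (auto simp: coef_eq L2_inner_commute)
  have pp: "L2_inner p p = (\<Sum>i\<in>F. c i * c i)"
    unfolding inner_p[OF p] using F inner_basis_sum[OF F, of _ c, folded p_def]
    by (intro sum.cong) (auto simp: L2_inner_commute[of _ p])
  have "L2_inner (\<lambda>x. f x - p x) (\<lambda>x. f x - p x) = L2_inner f (\<lambda>x. f x - p x) - L2_inner p (\<lambda>x. f x - p x)"
    by (rule L2_inner_diff_left[OF f p L2_diff[OF f p]])
  also have "\<dots> = (L2_inner f f - L2_inner p f) - (L2_inner p f - L2_inner p p)"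
    unfolding L2_inner_commute[of f "\<lambda>x. f x - p x"] L2_inner_commute[of p "\<lambda>x. f x - p x"]
    using L2_inner_diff_left[OF f p f] L2_inner_diff_left[OF f p p] L2_inner_commute[of f p] by simp
  also have "\<dots> = L2_inner f f - 2 * (\<Sum>i\<in>F. c i * coef B f i) + (\<Sum>i\<in>F. c i * c i)"
    by (simp add: pf pp)
  also have "\<dots> = L2_inner f f - (\<Sum>i\<in>F. (coef B f i)\<^sup>2) + (\<Sum>i\<in>F. (c i - coef B f i)\<^sup>2)"
    by (simp add: power2_diff sum.distrib sum_subtractf sum_distrib_left mult.assoc flip: power2_eq_square)
  finally show ?thesis .
qed

lemma parseval_self:
  assumes f: "f \<in> L2"
  shows "((\<lambda>i. (coef B f i)\<^sup>2) has_sum L2_inner f f) (indices B)"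
  unfolding has_sum_def
proof (rule tendstoI)
  fix e :: real assume e: "e > 0"
  \<comment> \<open>\<open>L2_dist\<close> is the root of the quantity to be bounded, hence
    \<open>sqrt e\<close>. Replacing \<open>c\<close> by the true coefficients only improves the
    approximation, and enlarging \<open>F\<close> afterwards raises the partial sum without passing
    the Bessel bound.\<close>
  obtain F c where F: "finite F" "F \<subseteq> indices B"
    and d: "L2_dist f (\<lambda>x. \<Sum>i\<in>F. c i * basis_fun B i x) < sqrt e"
    using basis_dense[OF f, of "sqrt e"] e by auto
  have lo: "L2_inner f f - (\<Sum>i\<in>F. (coef B f i)\<^sup>2) < e"
  proof -
    have "L2_inner f f - (\<Sum>i\<in>F. (coef B f i)\<^sup>2) \<le>
      L2_inner (\<lambda>x. f x - (\<Sum>i\<in>F. c i * basis_fun B i x)) (\<lambda>x. f x - (\<Sum>i\<in>F. c i * basis_fun B i x))"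
      unfolding norm_diff_basis_sum[OF f F] by (simp add: sum_nonneg)
    also have "\<dots> < e"
      using d by (simp add: L2_dist_def L2_norm_def)
    finally show ?thesis .
  qed
  have "dist (\<Sum>i\<in>Y. (coef B f i)\<^sup>2) (L2_inner f f) < e" if Y: "finite Y" "F \<subseteq> Y" "Y \<subseteq> indices B" for Y
  proof -
    have "(\<Sum>i\<in>F. (coef B f i)\<^sup>2) \<le> (\<Sum>i\<in>Y. (coef B f i)\<^sup>2)"
      using Y by (intro sum_mono2) auto
    moreover have "(\<Sum>i\<in>Y. (coef B f i)\<^sup>2) \<le> L2_inner f f"
      using norm_diff_basis_sum[OF f Y(1,3), of "coef B f"]
        L2_inner_self_nonneg[of "\<lambda>x. f x - (\<Sum>i\<in>Y. coef B f i * basis_fun B i x)"] by simp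
    ultimately show ?thesis using lo by (simp add: dist_real_def)
  qed
  then show "\<forall>\<^sub>F Y in finite_subsets_at_top (indices B). dist (\<Sum>i\<in>Y. (coef B f i)\<^sup>2) (L2_inner f f) < e"
    unfolding eventually_finite_subsets_at_top using F by (intro exI[of _ F]) auto
qed

lemma coef_add: "f \<in> L2 \<Longrightarrow> h \<in> L2 \<Longrightarrow> coef B (\<lambda>x. f x + h x) i = coef B f i + coef B h i"
  by (simp add: coef_eq L2_inner_add_left basis_fun_L2)

lemma coef_diff: "f \<in> L2 \<Longrightarrow> h \<in> L2 \<Longrightarrow> coef B (\<lambda>x. f x - h x) i = coef B f i - coef B h i"
  by (simp add: coef_eq L2_inner_diff_left basis_fun_L2)

text \<open>Polarisation of the identity for squares, applied to the sum and the difference of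
  \<open>f\<close> and \<open>h\<close>; it yields the summability of the products together with the
  value.\<close>

lemma parseval:
  assumes f: "f \<in> L2" and h: "h \<in> L2"
  shows "((\<lambda>i. coef B f i * coef B h i) has_sum L2_inner f h) (indices B)"
proof -
  have exp: "L2_inner (\<lambda>x. f x + h x) (\<lambda>x. f x + h x) = L2_inner f f + 2 * L2_inner f h + L2_inner h h"
    "L2_inner (\<lambda>x. f x - h x) (\<lambda>x. f x - h x) = L2_inner f f - 2 * L2_inner f h + L2_inner h h"
    using f h L2_add[OF f h] L2_diff[OF f h] L2_inner_commute[of h f]
    by (simp_all add: L2_inner_add_left L2_inner_diff_left
      L2_inner_commute[of f "\<lambda>x. f x + h x"] L2_inner_commute[of h "\<lambda>x. f x + h x"]
      L2_inner_commute[of f "\<lambda>x. f x - h x"] L2_inner_commute[of h "\<lambda>x. f x - h x"])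
  have "((\<lambda>i. 1 / 4 * ((coef B (\<lambda>x. f x + h x) i)\<^sup>2 + - (coef B (\<lambda>x. f x - h x) i)\<^sup>2)) has_sum
     1 / 4 * (L2_inner (\<lambda>x. f x + h x) (\<lambda>x. f x + h x) + - L2_inner (\<lambda>x. f x - h x) (\<lambda>x. f x - h x))) (indices B)"
    by (intro has_sum_cmult_right has_sum_add has_sum_uminusI parseval_self L2_add L2_diff f h)
  moreover have "1 / 4 * ((coef B (\<lambda>x. f x + h x) i)\<^sup>2 + - (coef B (\<lambda>x. f x - h x) i)\<^sup>2) = coef B f i * coef B h i" for i
    by (simp add: coef_add[OF f h] coef_diff[OF f h] power2_eq_square algebra_simps)
  moreover have "1 / 4 * (L2_inner (\<lambda>x. f x + h x) (\<lambda>x. f x + h x) + - L2_inner (\<lambda>x. f x - h x) (\<lambda>x. f x - h x)) = L2_inner f h"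
    by (simp add: exp)
  ultimately show ?thesis by simp
qed

end

subsection \<open>The space of linear forms and the extended functional\<close>

text \<open>The bound 2 keeps the logarithm of the characteristic sequence positive and away from 0,
  so that the weights are positive and bounded above.\<close>

locale H_basis = L2_basis +
  fixes \<delta> :: real
  assumes char_seq_ge: "\<And>l k. (l, k) \<in> indices B \<Longrightarrow> 2 \<le> char_seq B l"
    and \<delta>_pos: "0 < \<delta>"
begin

definition weight :: "int \<times> int \<Rightarrow> real" where
  "weight i = inverse (char_seq B (fst i)) * ln (char_seq B (fst i)) powr (- 2 * \<delta>)"

lemma H_term_eq: "H_term B \<delta> x i = weight i * (x i)\<^sup>2"
  by (simp add: H_term_def weight_def split_beta)

lemma weight_pos: "i \<in> indices B \<Longrightarrow> 0 < weight i"
  using char_seq_ge[of "fst i" "snd i"] by (simp add: weight_def)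

lemma weight_le: "i \<in> indices B \<Longrightarrow> weight i \<le> ln 2 powr (- 2 * \<delta>)"
proof -
  assume "i \<in> indices B"
  then have a: "2 \<le> char_seq B (fst i)" using char_seq_ge[of "fst i" "snd i"] by simp
  then have "ln (char_seq B (fst i)) powr (- 2 * \<delta>) \<le> ln 2 powr (- 2 * \<delta>)"
    using \<delta>_pos by (intro powr_mono2') auto
  moreover have "inverse (char_seq B (fst i)) \<le> 1"
    using a by (simp add: inverse_le_1_iff)
  ultimately have "weight i \<le> 1 * ln 2 powr (- 2 * \<delta>)"
    unfolding weight_def using a by (intro mult_mono) auto
  then show ?thesis by simp
qed

lemma H_term_nonneg: "i \<in> indices B \<Longrightarrow> 0 \<le> H_term B \<delta> x i"
  using weight_pos[of i] by (simp add: H_term_eq)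

lemma H_summable: "x \<in> H_space B \<delta> \<Longrightarrow> H_term B \<delta> x summable_on indices B"
  by (simp add: H_space_def)

lemma H_scale:
  assumes "x \<in> H_space B \<delta>"
  shows "(\<lambda>i. c * x i) \<in> H_space B \<delta>" "H_norm B \<delta> (\<lambda>i. c * x i) = \<bar>c\<bar> * H_norm B \<delta> x"
proof -
  have eq: "H_term B \<delta> (\<lambda>i. c * x i) = (\<lambda>i. c\<^sup>2 * H_term B \<delta> x i)"
    by (auto simp: H_term_eq power_mult_distrib)
  show "(\<lambda>i. c * x i) \<in> H_space B \<delta>"
    using assms by (auto simp: H_space_def eq intro: summable_on_cmult_right)
  show "H_norm B \<delta> (\<lambda>i. c * x i) = \<bar>c\<bar> * H_norm B \<delta> x"
    by (simp add: H_norm_def eq infsum_cmult_right' real_sqrt_mult)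
qed

lemma H_add:
  assumes "x \<in> H_space B \<delta>" "y \<in> H_space B \<delta>"
  shows "(\<lambda>i. x i + y i) \<in> H_space B \<delta>"
proof -
  have "H_term B \<delta> (\<lambda>i. x i + y i) summable_on indices B"
  proof (rule summable_on_comparison_test)
    show "(\<lambda>i. 2 * (H_term B \<delta> x i + H_term B \<delta> y i)) summable_on indices B"
      using assms by (intro summable_on_cmult_right summable_on_add H_summable)
    fix i assume i: "i \<in> indices B"
    have "(x i + y i)\<^sup>2 \<le> 2 * ((x i)\<^sup>2 + (y i)\<^sup>2)"
      using sum_squares_bound[of "x i" "y i"] by (simp add: power2_sum)
    from mult_left_mono[OF this, of "weight i"] weight_pos[OF i]
    show "H_term B \<delta> (\<lambda>i. x i + y i) i \<le> 2 * (H_term B \<delta> x i + H_term B \<delta> y i)"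
      by (simp add: H_term_eq algebra_simps)
  qed (rule H_term_nonneg)
  then show ?thesis using assms by (simp add: H_space_def)
qed

lemma H_diff: "x \<in> H_space B \<delta> \<Longrightarrow> y \<in> H_space B \<delta> \<Longrightarrow> (\<lambda>i. x i - y i) \<in> H_space B \<delta>"
  using H_add[of x "\<lambda>i. - 1 * y i"] H_scale(1)[of y "- 1"] by simp

lemma H_norm_nonneg: "0 \<le> H_norm B \<delta> x"
  unfolding H_norm_def by (intro real_sqrt_ge_zero infsum_nonneg H_term_nonneg)

lemma H_norm_square: "(H_norm B \<delta> x)\<^sup>2 = infsum (H_term B \<delta> x) (indices B)"
  unfolding H_norm_def by (intro real_sqrt_pow2 infsum_nonneg H_term_nonneg)

lemma coef_H:
  assumes f: "f \<in> L2"
  shows "coef B f \<in> H_space B \<delta>" "H_norm B \<delta> (coef B f) \<le> sqrt (ln 2 powr (- 2 * \<delta>)) * L2_norm f"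
proof -
  let ?C = "ln 2 powr (- 2 * \<delta>)"
  note P = has_sum_cmult_right[OF parseval_self[OF f], of ?C]
  have le: "H_term B \<delta> (coef B f) i \<le> ?C * (coef B f i)\<^sup>2" if "i \<in> indices B" for i
    using weight_le[OF that] by (auto simp: H_term_eq intro: mult_right_mono)
  have sm: "H_term B \<delta> (coef B f) summable_on indices B"
    by (rule summable_on_comparison_test[OF has_sum_imp_summable[OF P] le H_term_nonneg])
  then show "coef B f \<in> H_space B \<delta>"
    by (simp add: H_space_def coef_eq)
  have "infsum (H_term B \<delta> (coef B f)) (indices B) \<le> ?C * L2_inner f f"
    using has_sum_mono[OF has_sum_infsum[OF sm] P le] .
  then show "H_norm B \<delta> (coef B f) \<le> sqrt ?C * L2_norm f"
    by (simp add: H_norm_def L2_norm_def real_sqrt_mult[symmetric])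
qed

lemma H_dist_coef_le:
  assumes "f \<in> L2" "h \<in> L2"
  shows "H_dist B \<delta> (coef B f) (coef B h) \<le> sqrt (ln 2 powr (- 2 * \<delta>)) * L2_dist f h"
proof -
  have "(\<lambda>i. coef B f i - coef B h i) = coef B (\<lambda>x. f x - h x)"
    using coef_diff[OF assms] by auto
  with coef_H(2)[OF L2_diff[OF assms]] show ?thesis
    by (simp add: H_dist_def L2_dist_def)
qed

lemma measurable_coef: "coef B \<in> L2_borel \<rightarrow>\<^sub>M H_borel B \<delta>"
  unfolding L2_borel_def H_borel_def
  by (rule measurable_metric_borel_Lipschitz[where K = "sqrt (ln 2 powr (- 2 * \<delta>))"])
     (blast intro: coef_H(1), simp, rule H_dist_coef_le)

text \<open>Serves two maps: the observation, a shift by the signal plus scaled noise, and the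
  standardisation around the observation, with \<open>- c\<close> times the observation as the
  shift.\<close>

lemma measurable_H_affine:
  assumes "x \<in> H_space B \<delta>"
  shows "(\<lambda>w i. x i + c * w i) \<in> H_borel B \<delta> \<rightarrow>\<^sub>M H_borel B \<delta>"
  unfolding H_borel_def
proof (rule measurable_metric_borel_Lipschitz[where K = "\<bar>c\<bar>"])
  fix u v assume "u \<in> H_space B \<delta>" "v \<in> H_space B \<delta>"
  from H_scale(2)[OF H_diff[OF this], of c]
  show "H_dist B \<delta> (\<lambda>i. x i + c * u i) (\<lambda>i. x i + c * v i) \<le> \<bar>c\<bar> * H_dist B \<delta> u v"
    by (simp add: H_dist_def right_diff_distrib)
qed (use assms in \<open>auto intro: H_add H_scale\<close>)

text \<open>Density of \<open>L2\<close> in the space of forms: restricting \<open>x\<close> to a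
  finite index set gives the coefficients of a finite basis sum, and the squared distance is the
  tail of a convergent series.\<close>

lemma basis_sum_approx_H:
  assumes x: "x \<in> H_space B \<delta>" and e: "e > 0"
  obtains f where "f \<in> L2" "H_dist B \<delta> (coef B f) x < e"
proof -
  let ?t = "H_term B \<delta> x"
  note S = has_sum_infsum[OF H_summable[OF x]]
  have "0 < e\<^sup>2 / 2" using e by simp
  from has_sum_finite_approximation[OF S this]
  obtain F where F: "finite F" "F \<subseteq> indices B" "dist (sum ?t F) (infsum ?t (indices B)) \<le> e\<^sup>2 / 2" by blast
  define f where "f = (\<lambda>z. \<Sum>i\<in>F. x i * basis_fun B i z)"
  have f: "f \<in> L2" unfolding f_def by (rule basis_sum_L2[OF F(2)])
  have c: "coef B f i = (if i \<in> F then x i else 0)" for i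
    using inner_basis_sum[OF F(1,2), of i x] F(2) by (auto simp: coef_eq f_def)
  have "((\<lambda>i. if i \<in> F then ?t i else 0) has_sum sum ?t F) (indices B)"
    using F by (intro has_sum_finite_neutralI[of F]) auto
  from has_sum_add[OF S has_sum_uminusI[OF this]]
  have "((\<lambda>i. ?t i + - (if i \<in> F then ?t i else 0)) has_sum (infsum ?t (indices B) - sum ?t F)) (indices B)" by simp
  moreover have "?t i + - (if i \<in> F then ?t i else 0) = H_term B \<delta> (\<lambda>i. coef B f i - x i) i" for i
    by (simp add: H_term_eq c)
  ultimately have "(H_dist B \<delta> (coef B f) x)\<^sup>2 = infsum ?t (indices B) - sum ?t F"
    by (simp add: H_dist_def H_norm_square infsumI)
  also have "\<dots> < e\<^sup>2"
  proof -
    have "e\<^sup>2 > 0" using e by simp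
    with F(3) show ?thesis by (simp only: dist_real_def)
  qed
  finally have "H_dist B \<delta> (coef B f) x < e"
    using e by (intro power2_less_imp_less[of _ e]) auto
  with f show ?thesis by (rule that)
qed

end

text \<open>The summability condition places \<open>g\<close> in the dual of the weighted space,
  whose weights are the reciprocals of \<open>weight\<close>.\<close>

locale H_functional = H_basis +
  fixes g :: "real \<Rightarrow> real"
  assumes g_L2: "g \<in> L2"
    and g_summable: "(\<lambda>i. (coef B g i)\<^sup>2 / weight i) summable_on indices B"
begin

text \<open>\<open>L_ext\<close> is a definite description through limits; this series is the form
  in which linearity, Lipschitz bounds and the law under noise can be computed.\<close>

definition L_bar :: "form \<Rightarrow> real" where
  "L_bar x = infsum (\<lambda>i. x i * coef B g i) (indices B)"

text \<open>The norm of \<open>g\<close> in the dual weights, which serves as the Lipschitz constant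
  of \<open>L_bar\<close>.\<close>

definition L_const :: real where
  "L_const = sqrt (infsum (\<lambda>i. (coef B g i)\<^sup>2 / weight i) (indices B))"

lemma L_const_nonneg: "0 \<le> L_const"
  unfolding L_const_def by (intro real_sqrt_ge_zero infsum_nonneg divide_nonneg_pos weight_pos) auto

text \<open>Cauchy-Schwarz after splitting each product by the root of the weight. Absolute values
  inside the sum make one estimate give both absolute summability and the bound on the
  functional.\<close>

lemma finite_sum_bound:
  assumes x: "x \<in> H_space B \<delta>" and F: "finite F" "F \<subseteq> indices B"
  shows "(\<Sum>i\<in>F. \<bar>x i * coef B g i\<bar>) \<le> L_const * H_norm B \<delta> x"
proof -
  have wp: "weight i > 0" if "i \<in> F" for i using weight_pos F(2) that by blast
  have "(\<Sum>i\<in>F. \<bar>x i * coef B g i\<bar>) = (\<Sum>i\<in>F. (sqrt (weight i) * \<bar>x i\<bar>) * (\<bar>coef B g i\<bar> / sqrt (weight i)))"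
    by (intro sum.cong refl) (use wp in \<open>force simp: abs_mult\<close>)
  then have "(\<Sum>i\<in>F. \<bar>x i * coef B g i\<bar>)\<^sup>2 \<le>
     (\<Sum>i\<in>F. (sqrt (weight i) * \<bar>x i\<bar>)\<^sup>2) * (\<Sum>i\<in>F. (\<bar>coef B g i\<bar> / sqrt (weight i))\<^sup>2)"
    by (simp only: Cauchy_Schwarz_ineq_sum)
  also have "(\<Sum>i\<in>F. (sqrt (weight i) * \<bar>x i\<bar>)\<^sup>2) = (\<Sum>i\<in>F. H_term B \<delta> x i)"
    by (intro sum.cong refl) (use wp in \<open>simp add: power_mult_distrib H_term_eq less_imp_le\<close>)
  also have "(\<Sum>i\<in>F. (\<bar>coef B g i\<bar> / sqrt (weight i))\<^sup>2) = (\<Sum>i\<in>F. (coef B g i)\<^sup>2 / weight i)"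
    by (intro sum.cong refl) (use wp in \<open>simp add: power_divide less_imp_le\<close>)
  also have "(\<Sum>i\<in>F. H_term B \<delta> x i) * (\<Sum>i\<in>F. (coef B g i)\<^sup>2 / weight i) \<le> (H_norm B \<delta> x)\<^sup>2 * L_const\<^sup>2"
  proof (rule mult_mono)
    show "(\<Sum>i\<in>F. H_term B \<delta> x i) \<le> (H_norm B \<delta> x)\<^sup>2"
      unfolding H_norm_square using F
      by (intro finite_sum_le_infsum H_summable[OF x]) (auto intro: H_term_nonneg)
    have "(\<Sum>i\<in>F. (coef B g i)\<^sup>2 / weight i) \<le> infsum (\<lambda>i. (coef B g i)\<^sup>2 / weight i) (indices B)"
      using F by (intro finite_sum_le_infsum g_summable) (auto intro!: divide_nonneg_pos weight_pos)
    also have "\<dots> = L_const\<^sup>2"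
      unfolding L_const_def by (subst real_sqrt_pow2) (auto intro!: infsum_nonneg divide_nonneg_pos weight_pos)
    finally show "(\<Sum>i\<in>F. (coef B g i)\<^sup>2 / weight i) \<le> L_const\<^sup>2" .
    show "0 \<le> (\<Sum>i\<in>F. (coef B g i)\<^sup>2 / weight i)"
      using wp by (intro sum_nonneg divide_nonneg_pos) auto
  qed simp
  also have "\<dots> = (L_const * H_norm B \<delta> x)\<^sup>2" by (simp add: power_mult_distrib)
  finally show ?thesis
    by (rule power2_le_imp_le) (simp add: L_const_nonneg H_norm_nonneg)
qed

lemma L_bar_has_sum:
  assumes x: "x \<in> H_space B \<delta>"
  shows "((\<lambda>i. x i * coef B g i) has_sum L_bar x) (indices B)"
proof -
  have "(\<lambda>i. \<bar>x i * coef B g i\<bar>) summable_on indices B"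
    using finite_sum_bound[OF x] by (intro nonneg_bdd_above_summable_on bdd_aboveI2) auto
  then have "(\<lambda>i. x i * coef B g i) summable_on indices B"
    by (subst summable_on_iff_abs_summable_on_real) simp
  then show ?thesis unfolding L_bar_def by (rule has_sum_infsum)
qed

lemma L_bar_bound:
  assumes x: "x \<in> H_space B \<delta>"
  shows "\<bar>L_bar x\<bar> \<le> L_const * H_norm B \<delta> x"
proof -
  have "\<bar>\<Sum>i\<in>F. x i * coef B g i\<bar> \<le> L_const * H_norm B \<delta> x" if "finite F" "F \<subseteq> indices B" for F
    using finite_sum_bound[OF x that] sum_abs[of "\<lambda>i. x i * coef B g i" F] by linarith
  then have "L_bar x \<le> L_const * H_norm B \<delta> x" "- L_bar x \<le> L_const * H_norm B \<delta> x"
    using has_sum_le_finite_sums[OF L_bar_has_sum[OF x]]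
      has_sum_le_finite_sums[OF has_sum_uminusI[OF L_bar_has_sum[OF x]]]
    by (force simp: sum_negf abs_le_iff)+
  then show ?thesis by linarith
qed

lemma L_bar_add: "x \<in> H_space B \<delta> \<Longrightarrow> y \<in> H_space B \<delta> \<Longrightarrow> L_bar (\<lambda>i. x i + y i) = L_bar x + L_bar y"
  unfolding L_bar_def[of "\<lambda>i. x i + y i"]
  using has_sum_add[OF L_bar_has_sum L_bar_has_sum] by (intro infsumI) (simp add: distrib_right)

lemma L_bar_scale: "x \<in> H_space B \<delta> \<Longrightarrow> L_bar (\<lambda>i. c * x i) = c * L_bar x"
  by (simp add: L_bar_def mult.assoc infsum_cmult_right')

lemma L_bar_diff: "x \<in> H_space B \<delta> \<Longrightarrow> y \<in> H_space B \<delta> \<Longrightarrow> L_bar (\<lambda>i. x i - y i) = L_bar x - L_bar y"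
  using L_bar_add[of x "\<lambda>i. - 1 * y i"] H_scale(1)[of y "- 1"] L_bar_scale[of y "- 1"] by simp

lemma L_bar_Lipschitz:
  assumes "x \<in> H_space B \<delta>" "y \<in> H_space B \<delta>"
  shows "\<bar>L_bar x - L_bar y\<bar> \<le> L_const * H_dist B \<delta> x y"
  using L_bar_bound[OF H_diff[OF assms]] by (simp add: L_bar_diff[OF assms] H_dist_def)

lemma L_bar_coef: "f \<in> L2 \<Longrightarrow> L_bar (coef B f) = L2_inner f g"
  unfolding L_bar_def by (rule infsumI[OF parseval[OF _ g_L2]])

lemma L_bar_measurable: "L_bar \<in> borel_measurable (H_borel B \<delta>)"
  unfolding H_borel_def borel_eq_metric_borel
  by (rule measurable_metric_borel_Lipschitz[where K = L_const])
     (auto simp: dist_real_def L_const_nonneg intro: L_bar_Lipschitz)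

lemma L_ext_eq_L_bar:
  assumes x: "x \<in> H_space B \<delta>"
  shows "L_ext B \<delta> g x = L_bar x"
  unfolding L_ext_def
proof (rule the_equality)
  show lim: "\<forall>F. (\<forall>j. F j \<in> L2) \<and> (\<lambda>j. H_dist B \<delta> (coef B (F j)) x) \<longlonglongrightarrow> 0 \<longrightarrow> (\<lambda>j. L2_inner (F j) g) \<longlonglongrightarrow> L_bar x"
  proof (intro allI impI, elim conjE)
    fix F :: "nat \<Rightarrow> real \<Rightarrow> real"
    assume F: "\<forall>j. F j \<in> L2" and d: "(\<lambda>j. H_dist B \<delta> (coef B (F j)) x) \<longlonglongrightarrow> 0"
    have "(\<lambda>j. L_bar (coef B (F j))) \<longlonglongrightarrow> L_bar x"
    proof (rule LIM_zero_cancel, rule Lim_null_comparison)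
      show "(\<lambda>j. L_const * H_dist B \<delta> (coef B (F j)) x) \<longlonglongrightarrow> 0"
        using tendsto_mult_right_zero[OF d] .
      show "\<forall>\<^sub>F j in sequentially. norm (L_bar (coef B (F j)) - L_bar x) \<le> L_const * H_dist B \<delta> (coef B (F j)) x"
        using F by (intro always_eventually allI) (simp add: L_bar_Lipschitz coef_H x)
    qed
    then show "(\<lambda>j. L2_inner (F j) g) \<longlonglongrightarrow> L_bar x"
      using F by (simp add: L_bar_coef)
  qed
  fix v assume v: "\<forall>F. (\<forall>j. F j \<in> L2) \<and> (\<lambda>j. H_dist B \<delta> (coef B (F j)) x) \<longlonglongrightarrow> 0 \<longrightarrow> (\<lambda>j. L2_inner (F j) g) \<longlonglongrightarrow> v"
  \<comment> \<open>Uniqueness needs at least one sequence converging to \<open>x\<close>: without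
    it the condition on \<open>v\<close> would hold vacuously for every real number.\<close>
  have "\<forall>j. \<exists>f. f \<in> L2 \<and> H_dist B \<delta> (coef B f) x < 1 / real (Suc j)"
  proof
    fix j
    obtain f where "f \<in> L2" "H_dist B \<delta> (coef B f) x < 1 / real (Suc j)"
      using basis_sum_approx_H[OF x, of "1 / real (Suc j)"] by auto
    then show "\<exists>f. f \<in> L2 \<and> H_dist B \<delta> (coef B f) x < 1 / real (Suc j)" by blast
  qed
  then obtain F where F: "\<And>j. F j \<in> L2" "\<And>j. H_dist B \<delta> (coef B (F j)) x < 1 / real (Suc j)" by metis
  have "(\<lambda>j. H_dist B \<delta> (coef B (F j)) x) \<longlonglongrightarrow> 0"
  proof (rule Lim_null_comparison[OF always_eventually LIMSEQ_Suc[OF lim_1_over_n]], intro allI)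
    show "norm (H_dist B \<delta> (coef B (F j)) x) \<le> 1 / of_nat (Suc j)" for j
      using F(2)[of j] by (simp add: H_dist_def H_norm_nonneg)
  qed
  with F lim v show "v = L_bar x"
    by (metis LIMSEQ_unique)
qed

lemma L_ext_measurable: "L_ext B \<delta> g \<in> borel_measurable (H_borel B \<delta>)"
  using L_bar_measurable
  by (subst measurable_cong[of _ _ L_bar]) (simp_all add: L_ext_eq_L_bar H_borel_def)

end

subsection \<open>The law of the functional under white noise\<close>

lemma (in prob_space) char_scaled_std_normal:
  assumes [measurable]: "random_variable borel X" and X: "distr M borel X = std_normal_distribution"
  shows "char (distr M borel (\<lambda>x. X x * c)) t = complex_of_real (exp (- ((c * t)\<^sup>2) / 2))"
proof -
  have "char (distr M borel (\<lambda>x. X x * c)) t = char (distr M borel X) (c * t)"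
    by (simp add: char_def integral_distr mult_ac)
  then show ?thesis by (simp add: X char_std_normal_distribution)
qed

lemma distr_scaled_std_normal:
  assumes "0 < \<sigma>"
  shows "distr std_normal_distribution borel (\<lambda>x. x * \<sigma>) = density lborel (normal_density 0 \<sigma>)"
proof -
  interpret prob_space std_normal_distribution
    by (rule prob_space_normal_density) simp
  have "distributed std_normal_distribution lborel (\<lambda>x. x) (normal_density 0 1)"
    unfolding distributed_def by (simp add: distr_id2)
  from normal_density_affine[OF this, of \<sigma> 0] assms
  have "distributed std_normal_distribution lborel (\<lambda>x. x * \<sigma>) (normal_density 0 \<sigma>)"
    by (simp add: mult.commute)
  from distributed_distr_eq_density[OF this] show ?thesis
    by (simp cong: distr_cong)
qed

lemma char_normal:
  assumes "0 < \<sigma>"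
  shows "char (density lborel (normal_density 0 \<sigma>)) t = complex_of_real (exp (- ((\<sigma> * t)\<^sup>2) / 2))"
proof -
  interpret prob_space std_normal_distribution
    by (rule prob_space_normal_density) simp
  show ?thesis
    unfolding distr_scaled_std_normal[OF assms, symmetric]
    by (rule char_scaled_std_normal) (simp_all add: distr_id2)
qed

lemma (in H_functional) distr_L_bar_white_noise:
  assumes N: "white_noise_law B \<delta> N" and g: "0 < L2_norm g"
  shows "distr N borel L_bar = density lborel (normal_density 0 (L2_norm g))"
proof -
  have sets_N: "sets N = sets (H_borel B \<delta>)" and "prob_space N"
    using N by (auto simp: white_noise_law_def space_prob_algebra)
  interpret prob_space N by fact
  have space_N: "space N = H_space B \<delta>"
    using sets_eq_imp_space_eq[OF sets_N] by (simp add: H_borel_def)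
  have indep: "indep_vars (\<lambda>_. borel) (\<lambda>i w. w i) (indices B)"
    and std: "\<And>i. i \<in> indices B \<Longrightarrow> distr N borel (\<lambda>w. w i) = std_normal_distribution"
    using N by (auto simp: white_noise_law_def)
  have rv: "random_variable borel (\<lambda>w. w i)" if "i \<in> indices B" for i
    using indep that by (auto simp: indep_vars_def)
  have L: "L_bar \<in> borel_measurable N"
    using L_bar_measurable measurable_cong_sets[OF sets_N refl] by blast
  \<comment> \<open>An increasing exhaustion of the countable index set by finite sets; it turns
    summation along the net of finite subsets into a sequential limit, as dominated convergence
    requires.\<close>
  define F where "F k = {i \<in> indices B. to_nat i < k}" for k
  have F: "finite (F k)" "F k \<subseteq> indices B" for k
    using finite_vimageI[OF finite_lessThan[of k] inj_to_nat]
    by (auto simp: F_def vimage_def elim: rev_finite_subset)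
  have F_lim: "filterlim F (finite_subsets_at_top (indices B)) sequentially"
    unfolding filterlim_finite_subsets_at_top
  proof (intro allI impI, elim conjE)
    fix X assume X: "finite X" "X \<subseteq> indices B"
    have "\<forall>\<^sub>F k in sequentially. \<forall>i\<in>X. to_nat i < k"
      using X(1) by (intro eventually_ball_finite ballI eventually_gt_at_top)
    then show "\<forall>\<^sub>F k in sequentially. finite (F k) \<and> X \<subseteq> F k \<and> F k \<subseteq> indices B"
      by eventually_elim (use F X in \<open>auto simp: F_def\<close>)
  qed
  define S where "S k w = (\<Sum>i\<in>F k. w i * coef B g i)" for k and w :: form
  have S: "S k \<in> borel_measurable N" for k
    unfolding S_def[abs_def] using F by (intro borel_measurable_sum borel_measurable_times rv) auto
  have "char (distr N borel L_bar) t = char (density lborel (normal_density 0 (L2_norm g))) t" for t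
  proof (rule LIMSEQ_unique)
    \<comment> \<open>The series converges at every point of the space of forms, and the
      exponentials have modulus 1, so the constant 1 dominates.\<close>
    have "(\<lambda>k. CLINT w|N. iexp (t * S k w)) \<longlonglongrightarrow> (CLINT w|N. iexp (t * L_bar w))"
    proof (rule integral_dominated_convergence[where w = "\<lambda>_. 1"])
      show "AE w in N. (\<lambda>k. iexp (t * S k w)) \<longlonglongrightarrow> iexp (t * L_bar w)"
      proof (rule AE_I2)
        fix w assume "w \<in> space N"
        then have "((\<lambda>i. w i * coef B g i) has_sum L_bar w) (indices B)"
          unfolding space_N by (rule L_bar_has_sum)
        then have "(\<lambda>k. S k w) \<longlonglongrightarrow> L_bar w"
          unfolding has_sum_def S_def using F_lim by (rule filterlim_compose)
        then show "(\<lambda>k. iexp (t * S k w)) \<longlonglongrightarrow> iexp (t * L_bar w)"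
          by (intro tendsto_intros)
      qed
    qed (use S L in auto)
    then show "(\<lambda>k. char (distr N borel (S k)) t) \<longlonglongrightarrow> char (distr N borel L_bar) t"
      using S L by (simp add: char_def integral_distr)
    have "char (distr N borel (S k)) t = complex_of_real (exp (- ((\<Sum>i\<in>F k. (coef B g i)\<^sup>2) * t\<^sup>2) / 2))" for k
    proof -
      have "indep_vars (\<lambda>_. borel) (\<lambda>i w. w i * coef B g i) (F k)"
        by (rule indep_vars_compose2[OF indep_vars_subset[OF indep F(2)], where Y = "\<lambda>i z. z * coef B g i" and N = "\<lambda>_. borel"]) simp
      then have "char (distr N borel (S k)) t = (\<Prod>i\<in>F k. char (distr N borel (\<lambda>w. w i * coef B g i)) t)"
        unfolding S_def[abs_def] by (rule char_distr_sum)
      also have "\<dots> = (\<Prod>i\<in>F k. complex_of_real (exp (- ((coef B g i * t)\<^sup>2) / 2)))"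
        using F by (intro prod.cong refl char_scaled_std_normal rv std) auto
      also have "\<dots> = complex_of_real (exp (\<Sum>i\<in>F k. - ((coef B g i * t)\<^sup>2) / 2))"
        by (simp add: exp_sum F)
      also have "(\<Sum>i\<in>F k. - ((coef B g i * t)\<^sup>2) / 2) = - ((\<Sum>i\<in>F k. (coef B g i)\<^sup>2) * t\<^sup>2) / 2"
        by (simp add: power_mult_distrib sum_distrib_right sum_divide_distrib sum_negf)
      finally show ?thesis .
    qed
    moreover have "(\<lambda>k. \<Sum>i\<in>F k. (coef B g i)\<^sup>2) \<longlonglongrightarrow> L2_inner g g"
      using parseval_self[OF g_L2] F_lim unfolding has_sum_def by (rule filterlim_compose)
    then have "(\<lambda>k. complex_of_real (exp (- ((\<Sum>i\<in>F k. (coef B g i)\<^sup>2) * t\<^sup>2) / 2))) \<longlonglongrightarrow>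
        complex_of_real (exp (- (L2_inner g g * t\<^sup>2) / 2))"
      by (intro tendsto_intros) auto
    ultimately show "(\<lambda>k. char (distr N borel (S k)) t) \<longlonglongrightarrow> char (density lborel (normal_density 0 (L2_norm g))) t"
      by (simp add: char_normal[OF g] power_mult_distrib L2_norm_square)
  qed
  then show ?thesis
    using real_distribution_normal[OF g] real_distribution_distr[OF L] by (intro Levy_uniqueness) auto
qed

section \<open>Sobolev regularity and the dual of the space of forms\<close>

lemma regular_basis_char_seq_ge:
  assumes "regular_basis S B" "(l, k) \<in> indices B"
  shows "2 \<le> char_seq B l"
proof -
  have l: "l \<in> levels B" using assms(2) by (simp add: indices_def)
  consider "char_seq B l = max 2 (real_of_int \<bar>l\<bar>)" | "l \<ge> 1" "char_seq B l = 2 ^ nat l"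
    using assms(1) l unfolding regular_basis_def by auto
  then show ?thesis
  proof cases
    case 2
    then have "(2::real) ^ 1 \<le> 2 ^ nat l" by (intro power_increasing) auto
    with 2 show ?thesis by simp
  qed simp
qed

text \<open>A power of the logarithm is absorbed by the surplus exponent \<open>2 s - 1 > 0\<close>.\<close>

lemma inverse_weight_le:
  fixes a s \<delta> :: real
  assumes a: "1 < a" and s: "1 / 2 < s" and \<delta>: "0 < \<delta>"
  shows "a * ln a powr (2 * \<delta>) \<le> (2 * \<delta> / (2 * s - 1)) powr (2 * \<delta>) * a powr (2 * s)"
proof -
  \<comment> \<open>The exponent satisfies \<open>p * (2 * \<delta>) = 2 * s - 1\<close>, so raising
    \<open>ln a \<le> a powr p / p\<close> to the power \<open>2 * \<delta>\<close> uses up exactly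
    the surplus.\<close>
  define p where "p = (2 * s - 1) / (2 * \<delta>)"
  have p: "p > 0" using s \<delta> by (simp add: p_def)
  have "ln a \<le> a powr p / p" using a p by (intro ln_powr_bound) auto
  then have "ln a powr (2 * \<delta>) \<le> (a powr p / p) powr (2 * \<delta>)"
    using a \<delta> by (intro powr_mono2) auto
  also have "\<dots> = (a powr p * (1 / p)) powr (2 * \<delta>)"
    by simp
  also have "\<dots> = a powr (2 * s - 1) * (1 / p) powr (2 * \<delta>)"
  proof -
    have "p * (2 * \<delta>) = 2 * s - 1" using \<delta> by (simp add: p_def)
    then show ?thesis using p by (subst powr_mult) (simp_all add: powr_powr)
  qed
  finally have "a * ln a powr (2 * \<delta>) \<le> a * (a powr (2 * s - 1) * (1 / p) powr (2 * \<delta>))"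
    using a by (intro mult_left_mono) auto
  also have "\<dots> = (a powr 1 * a powr (2 * s - 1)) * (1 / p) powr (2 * \<delta>)"
    using a by simp
  also have "a powr 1 * a powr (2 * s - 1) = a powr (2 * s)"
    by (subst powr_add[symmetric]) simp
  finally show ?thesis by (simp add: p_def mult.commute)
qed

text \<open>The reciprocal weights are dominated by a constant times the Sobolev weights, so the
  Sobolev series of \<open>g\<close> majorises its dual series.\<close>

lemma H_functional_sobolev:
  assumes B: "regular_basis S B" and s: "1 / 2 < s" and \<delta>: "0 < \<delta>" and g: "g \<in> sobolev B s"
  shows "H_functional B \<delta> g"
proof -
  interpret H_basis B \<delta>
    using B \<delta> regular_basis_char_seq_ge[OF B] by unfold_locales (auto simp: regular_basis_def)
  show ?thesis
  proof
    show "g \<in> L2" using g by (simp add: sobolev_def)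
    let ?K = "(2 * \<delta> / (2 * s - 1)) powr (2 * \<delta>)"
    show "(\<lambda>i. (coef B g i)\<^sup>2 / weight i) summable_on indices B"
    proof (rule summable_on_comparison_test)
      show "(\<lambda>i. ?K * (case i of (l, k) \<Rightarrow> char_seq B l powr (2 * s) * (L2_inner (psi B l k) g)\<^sup>2)) summable_on indices B"
        using g by (intro summable_on_cmult_right) (simp add: sobolev_def)
      fix i assume i: "i \<in> indices B"
      obtain l k where lk: "i = (l, k)" by (cases i)
      have a: "2 \<le> char_seq B l" using char_seq_ge i lk by simp
      have "(coef B g i)\<^sup>2 / weight i = (char_seq B l * ln (char_seq B l) powr (2 * \<delta>)) * (L2_inner (psi B l k) g)\<^sup>2"
        using i a by (simp add: lk coef_eq weight_def powr_minus field_simps L2_inner_commute)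
      also have "\<dots> \<le> (?K * char_seq B l powr (2 * s)) * (L2_inner (psi B l k) g)\<^sup>2"
        using a s \<delta> by (intro mult_right_mono inverse_weight_le) auto
      finally show "(coef B g i)\<^sup>2 / weight i \<le> ?K * (case i of (l, k) \<Rightarrow> char_seq B l powr (2 * s) * (L2_inner (psi B l k) g)\<^sup>2)"
        by (simp add: lk mult.assoc)
      show "0 \<le> (coef B g i)\<^sup>2 / weight i" using weight_pos[OF i] by simp
    qed
  qed
qed

lemma L2_norm_pos:
  assumes "g \<in> L2" "\<not> (AE x in lebI. g x = 0)"
  shows "0 < L2_norm g"
proof -
  have "L2_inner g g \<noteq> 0"
  proof
    assume "L2_inner g g = 0"
    then have "AE x in lebI. g x * g x = 0"
      using integral_nonneg_eq_0_iff_AE[OF L2_mult_integrable[OF assms(1,1)]] by (simp add: L2_inner_def)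
    with assms(2) show False by simp
  qed
  with L2_inner_self_nonneg[of g] show ?thesis by (simp add: L2_norm_def)
qed

subsection \<open>Credible sets for the functional\<close>

context H_functional
begin

lemma L2_inner_measurable: "(\<lambda>f. L2_inner f g) \<in> borel_measurable L2_borel"
  using measurable_compose[OF measurable_coef L_bar_measurable]
  by (subst measurable_cong[of _ _ "\<lambda>f. L_bar (coef B f)"]) (simp_all add: L_bar_coef L2_borel_def)

text \<open>By linearity, standardising before or after applying the functional gives the same
  result. The real posterior thus becomes a Lipschitz image of the measure appearing in
  \<open>weak_BvM\<close>.\<close>

lemma standardised_post_L:
  assumes \<mu>: "sets \<mu> = sets L2_borel" and x: "x \<in> H_space B \<delta>"
  shows "distr (post_L g \<mu>) borel (\<lambda>z. c * (z - L_ext B \<delta> g x)) =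
    distr (distr (distr \<mu> (H_borel B \<delta>) (coef B)) (H_borel B \<delta>) (\<lambda>h i. c * (h i - x i))) borel L_bar"
proof -
  have sp: "space \<mu> = L2"
    using sets_eq_imp_space_eq[OF \<mu>] by (simp add: L2_borel_def)
  have m1: "(\<lambda>f. L2_inner f g) \<in> borel_measurable \<mu>" and m2: "coef B \<in> \<mu> \<rightarrow>\<^sub>M H_borel B \<delta>"
    using L2_inner_measurable measurable_coef measurable_cong_sets[OF \<mu> refl] by blast+
  have m3: "(\<lambda>h i. c * (h i - x i)) \<in> H_borel B \<delta> \<rightarrow>\<^sub>M H_borel B \<delta>"
    using measurable_H_affine[OF H_scale(1)[OF x, of "- c"], of c] by (simp add: algebra_simps)
  have "distr (post_L g \<mu>) borel (\<lambda>z. c * (z - L_ext B \<delta> g x)) = distr \<mu> borel (\<lambda>f. c * (L2_inner f g - L_ext B \<delta> g x))"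
    unfolding post_L_def by (subst distr_distr) (use m1 in \<open>simp_all add: comp_def\<close>)
  also have "\<dots> = distr \<mu> borel (\<lambda>f. L_bar (\<lambda>i. c * (coef B f i - x i)))"
    using x by (intro distr_cong refl)
      (simp add: sp L_ext_eq_L_bar L_bar_scale[OF H_diff] coef_H(1) L_bar_diff L_bar_coef)
  also have "\<dots> = distr (distr \<mu> (H_borel B \<delta>) (\<lambda>f i. c * (coef B f i - x i))) borel L_bar"
    using measurable_compose[OF m2 m3] by (subst distr_distr) (simp_all add: comp_def L_bar_measurable)
  also have "distr \<mu> (H_borel B \<delta>) (\<lambda>f i. c * (coef B f i - x i)) =
      distr (distr \<mu> (H_borel B \<delta>) (coef B)) (H_borel B \<delta>) (\<lambda>h i. c * (h i - x i))"
    using m2 m3 by (subst distr_distr) (simp_all add: comp_def)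
  finally show ?thesis .
qed

end

section \<open>Consequences of the weak Bernstein-von Mises property for the functional\<close>

locale functional_bvm = H_functional +
  fixes f0 :: "real \<Rightarrow> real" and N :: "form measure" and post :: "nat \<Rightarrow> form \<Rightarrow> (real \<Rightarrow> real) measure"
  assumes noise: "white_noise_law B \<delta> N"
    and g_norm_pos: "0 < L2_norm g"
    and f0_L2: "f0 \<in> L2"
    and post: "n \<ge> 1 \<Longrightarrow> x \<in> H_space B \<delta> \<Longrightarrow> post n x \<in> space (prob_algebra L2_borel)"
    and BvM: "weak_BvM B \<delta> N post f0"
begin

abbreviation "P n \<equiv> obs_law B \<delta> N n f0"

abbreviation "limit_law \<equiv> density lborel (normal_density 0 (L2_norm g))"

abbreviation "std_post n x \<equiv>
  distr (post_L g (post n x)) borel (\<lambda>z. sqrt (real n) * (z - L_ext B \<delta> g x))"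

lemma noise_sets: "sets N = sets (H_borel B \<delta>)" and noise_prob: "prob_space N"
  using noise by (auto simp: white_noise_law_def space_prob_algebra)

lemma noise_space: "space N = H_space B \<delta>"
  using sets_eq_imp_space_eq[OF noise_sets] by (simp add: H_borel_def)

lemma obs_measurable: "(\<lambda>w i. coef B f0 i + w i / sqrt (real n)) \<in> N \<rightarrow>\<^sub>M H_borel B \<delta>"
  using measurable_H_affine[OF coef_H(1)[OF f0_L2], of "1 / sqrt (real n)"]
  by (simp add: measurable_cong_sets[OF noise_sets refl])

lemma P_prob: "prob_space (P n)"
  unfolding obs_law_def by (rule prob_space.prob_space_distr[OF noise_prob obs_measurable])

lemma P_sets: "sets (P n) = sets (H_borel B \<delta>)" and P_space: "space (P n) = H_space B \<delta>"
  by (simp_all add: obs_law_def H_borel_def)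

lemma P_measurable: "f \<in> H_borel B \<delta> \<rightarrow>\<^sub>M M \<Longrightarrow> f \<in> P n \<rightarrow>\<^sub>M M"
  using measurable_cong_sets[OF P_sets refl] by blast

lemma post_prob: "n \<ge> 1 \<Longrightarrow> x \<in> H_space B \<delta> \<Longrightarrow> prob_space (post n x)"
  and post_sets: "n \<ge> 1 \<Longrightarrow> x \<in> H_space B \<delta> \<Longrightarrow> sets (post n x) = sets L2_borel"
  using post by (auto simp: space_prob_algebra)

lemma post_L_measurable:
  "n \<ge> 1 \<Longrightarrow> x \<in> H_space B \<delta> \<Longrightarrow> (\<lambda>f. L2_inner f g) \<in> borel_measurable (post n x)"
  using L2_inner_measurable measurable_cong_sets[OF post_sets refl] by blast

lemma std_post_prob: "n \<ge> 1 \<Longrightarrow> x \<in> H_space B \<delta> \<Longrightarrow> prob_space (std_post n x)"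
  unfolding post_L_def
  by (intro prob_space.prob_space_distr post_prob post_L_measurable) auto

lemma noise_law: "distr N borel L_bar = limit_law"
  by (rule distr_L_bar_white_noise[OF noise g_norm_pos])

lemma std_post_tends: "tends_to_0_in_prob P (\<lambda>n x. bl_dist UNIV dist (std_post n x) limit_law)"
proof (rule tends_to_0_in_prob_transfer[OF BvM[unfolded weak_BvM_def] BvM[unfolded weak_BvM_def]])
  fix e :: real assume e: "e > 0"
  \<comment> \<open>The comparison of distances under a Lipschitz map asks for a constant of at
    least 1.\<close>
  define K where "K = max 1 L_const"
  have K: "1 \<le> K" "L_const \<le> K" by (auto simp: K_def)
  let ?\<mu> = "\<lambda>n x. distr (distr (post n x) (H_borel B \<delta>) (coef B)) (H_borel B \<delta>) (\<lambda>h i. sqrt (real n) * (h i - x i))"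
  have "\<bar>bl_dist UNIV dist (std_post n x) limit_law\<bar> \<le> e"
    if n: "n \<ge> 1" and x: "x \<in> H_space B \<delta>"
      and bl: "\<bar>bl_dist (H_space B \<delta>) (H_dist B \<delta>) (?\<mu> n x) N\<bar> \<le> e / K" for n x
  proof -
    have m: "coef B \<in> post n x \<rightarrow>\<^sub>M H_borel B \<delta>"
      using measurable_coef measurable_cong_sets[OF post_sets[OF n x] refl] by blast
    have m3: "(\<lambda>h i. sqrt (real n) * (h i - x i)) \<in> H_borel B \<delta> \<rightarrow>\<^sub>M H_borel B \<delta>"
      using measurable_H_affine[OF H_scale(1)[OF x, of "- sqrt (real n)"], of "sqrt (real n)"] by (simp add: algebra_simps)
    have "prob_space (?\<mu> n x)"
      by (intro prob_space.prob_space_distr post_prob n x m) (simp add: m3)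
    then have "bl_dist UNIV dist (distr (?\<mu> n x) borel L_bar) (distr N borel L_bar) \<le>
        K * bl_dist (H_space B \<delta>) (H_dist B \<delta>) (?\<mu> n x) N"
    proof (rule bl_dist_distr_Lipschitz[OF _ noise_prob _ noise_space])
      show "L_bar \<in> borel_measurable N"
        using L_bar_measurable measurable_cong_sets[OF noise_sets refl] by blast
      show "dist (L_bar y) (L_bar z) \<le> K * H_dist B \<delta> y z" if "y \<in> H_space B \<delta>" "z \<in> H_space B \<delta>" for y z
        using L_bar_Lipschitz[OF that] mult_right_mono[OF K(2), of "H_dist B \<delta> y z"]
        by (simp add: dist_real_def H_dist_def H_norm_nonneg)
    qed (use K L_bar_measurable in \<open>simp_all add: H_borel_def\<close>)
    also have "\<dots> \<le> K * (e / K)"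
      using K bl by (intro mult_left_mono) auto
    also have "\<dots> = e" using K by simp
    finally have "bl_dist UNIV dist (std_post n x) limit_law \<le> e"
      by (simp add: standardised_post_L[OF post_sets[OF n x] x] noise_law)
    moreover have "0 \<le> bl_dist UNIV dist (std_post n x) limit_law"
      using std_post_prob[OF n x] prob_space_normal_density[OF g_norm_pos] by (intro bl_dist_nonneg) auto
    ultimately show ?thesis by simp
  qed
  then show "\<exists>\<eta>>0. \<forall>n\<ge>1. AE x in P n. \<bar>bl_dist (H_space B \<delta>) (H_dist B \<delta>) (?\<mu> n x) N\<bar> \<le> \<eta> \<and>
      \<bar>bl_dist (H_space B \<delta>) (H_dist B \<delta>) (?\<mu> n x) N\<bar> \<le> \<eta> \<longrightarrow> \<bar>bl_dist UNIV dist (std_post n x) limit_law\<bar> \<le> e"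
    using e K by (intro exI[of _ "e / K"] conjI allI impI AE_I2) (auto simp: P_space)
qed

text \<open>The signal cancels and the factors \<open>sqrt n\<close> cancel, leaving the functional
  of the noise alone. At \<open>n = 0\<close> the left side would be a point mass.\<close>

lemma obs_law_L:
  assumes n: "n \<ge> 1"
  shows "distr (P n) borel (\<lambda>x. sqrt (real n) * (L_ext B \<delta> g x - L2_inner f0 g)) = limit_law"
proof -
  have "distr (P n) borel (\<lambda>x. sqrt (real n) * (L_ext B \<delta> g x - L2_inner f0 g)) =
      distr N borel (\<lambda>w. sqrt (real n) * (L_ext B \<delta> g (\<lambda>i. coef B f0 i + w i / sqrt (real n)) - L2_inner f0 g))"
    unfolding obs_law_def
    by (subst distr_distr[OF _ obs_measurable])
       (auto simp: comp_def intro!: borel_measurable_times borel_measurable_diff L_ext_measurable)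
  also have "\<dots> = distr N borel L_bar"
  proof (rule distr_cong[OF refl refl])
    fix w assume "w \<in> space N"
    then have w: "w \<in> H_space B \<delta>" by (simp add: noise_space)
    have "L_ext B \<delta> g (\<lambda>i. coef B f0 i + (1 / sqrt (real n)) * w i) = L2_inner f0 g + (1 / sqrt (real n)) * L_bar w"
      using H_add[OF coef_H(1)[OF f0_L2] H_scale(1)[OF w, of "1 / sqrt (real n)"]]
        L_bar_add[OF coef_H(1)[OF f0_L2] H_scale(1)[OF w, of "1 / sqrt (real n)"]]
      by (simp only: L_ext_eq_L_bar L_bar_scale[OF w] L_bar_coef[OF f0_L2])
    then show "sqrt (real n) * (L_ext B \<delta> g (\<lambda>i. coef B f0 i + w i / sqrt (real n)) - L2_inner f0 g) = L_bar w"
      using n by simp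
  qed
  finally show ?thesis by (simp add: noise_law)
qed

lemma L_ext_P_measurable: "L_ext B \<delta> g \<in> borel_measurable (P n)"
  by (rule P_measurable[OF L_ext_measurable])

text \<open>The standardised error of the centre \<open>c\<close> is an exactly normal term plus a
  vanishing recentring. Of the radius only its limit \<open>q\<close> enters, so \<open>c\<close>
  may differ from the centre around which \<open>R\<close> was calibrated.\<close>

lemma cred_set_coverage:
  assumes q: "0 < q" "normal_central (L2_norm g) q = 1 - \<alpha>"
    and c: "\<And>n. n \<ge> 1 \<Longrightarrow> c n \<in> borel_measurable (P n)"
      "tends_to_0_in_prob P (\<lambda>n x. sqrt (real n) * (c n x - L_ext B \<delta> g x))"
    and R: "\<And>n. n \<ge> 1 \<Longrightarrow> R n \<in> borel_measurable (P n)" "tends_to_0_in_prob P (\<lambda>n x. R n x - q)"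
  shows "coverage_tends P (L2_inner f0 g) (cred_set c R) (1 - \<alpha>)"
proof -
  let ?Z = "\<lambda>n x. sqrt (real n) * (L_ext B \<delta> g x - L2_inner f0 g)"
  let ?D = "\<lambda>n x. sqrt (real n) * (c n x - L_ext B \<delta> g x)"
  have "(\<lambda>n. measure (P n) {x \<in> space (P n). \<bar>?Z n x + ?D n x\<bar> \<le> R n x}) \<longlonglongrightarrow> normal_central (L2_norm g) q"
    using L_ext_P_measurable c R
    by (intro coverage_limit g_norm_pos q(1) P_prob obs_law_L) auto
  moreover have "\<forall>\<^sub>F n in sequentially. measure (P n) {x \<in> space (P n). \<bar>?Z n x + ?D n x\<bar> \<le> R n x} =
      measure (P n) {x \<in> space (P n). L2_inner f0 g \<in> cred_set c R n x}"
    using eventually_ge_at_top[of 1]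
  proof eventually_elim
    case (elim n)
    have "\<bar>?Z n x + ?D n x\<bar> \<le> R n x \<longleftrightarrow> L2_inner f0 g \<in> cred_set c R n x" for x
    proof -
      have "?Z n x + ?D n x = sqrt (real n) * (c n x - L2_inner f0 g)" by (simp add: algebra_simps)
      then have "\<bar>?Z n x + ?D n x\<bar> = \<bar>L2_inner f0 g - c n x\<bar> * sqrt (real n)"
        by (simp add: abs_mult abs_minus_commute)
      then show ?thesis using elim by (simp add: cred_set_def pos_le_divide_eq)
    qed
    then show ?case by simp
  qed
  ultimately show ?thesis
    unfolding coverage_tends_def q(2) by (rule Lim_transform_eventually)
qed

text \<open>Standardisation carries the interval of half-width \<open>R / sqrt n\<close> around
  \<open>c\<close> to the one of half-width \<open>R\<close> around the scaled offset of
  \<open>c\<close>, to which the stability of radii applies.\<close>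

lemma cred_radius_tends:
  assumes q: "0 < q" "normal_central (L2_norm g) q = 1 - \<alpha>"
    and c: "tends_to_0_in_prob P (\<lambda>n x. sqrt (real n) * (c n x - L_ext B \<delta> g x))"
    and R: "cred_radius P (\<lambda>n x. post_L g (post n x)) c \<alpha> R"
  shows "tends_to_0_in_prob P (\<lambda>n x. R n x - q)"
proof (rule credible_radius_tends[OF g_norm_pos q(1) _ _ std_post_tends c])
  fix n :: nat assume n: "n \<ge> 1"
  have "AE x in P n. measure (post_L g (post n x)) (cred_set c R n x) = 1 - \<alpha>"
    using R n by (auto simp: cred_radius_def)
  then show "AE x in P n. measure (std_post n x) {z. \<bar>z - sqrt (real n) * (c n x - L_ext B \<delta> g x)\<bar> \<le> R n x} =
      normal_central (L2_norm g) q"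
    using AE_space
  proof eventually_elim
    case (elim x)
    have "measure (std_post n x) {z. \<bar>z - sqrt (real n) * (c n x - L_ext B \<delta> g x)\<bar> \<le> R n x} =
      measure (post_L g (post n x)) ((\<lambda>z. sqrt (real n) * (z - L_ext B \<delta> g x)) -`
        {z. \<bar>z - sqrt (real n) * (c n x - L_ext B \<delta> g x)\<bar> \<le> R n x} \<inter> space (post_L g (post n x)))"
      by (rule measure_distr) (auto simp: post_L_def)
    also have "(\<lambda>z. sqrt (real n) * (z - L_ext B \<delta> g x)) -`
        {z. \<bar>z - sqrt (real n) * (c n x - L_ext B \<delta> g x)\<bar> \<le> R n x} \<inter> space (post_L g (post n x)) = cred_set c R n x"
    proof -
      have "\<bar>sqrt (real n) * (z - L_ext B \<delta> g x) - sqrt (real n) * (c n x - L_ext B \<delta> g x)\<bar> = \<bar>z - c n x\<bar> * sqrt (real n)" for z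
        by (simp add: right_diff_distrib[symmetric] abs_mult)
      then show ?thesis
        using n by (auto simp: post_L_def cred_set_def pos_le_divide_eq)
    qed
    finally show ?case using elim(1) q(2) by simp
  qed
qed (auto simp: P_space std_post_prob)

end

theorem theorem3:
  fixes B :: basis and S :: nat and s \<delta> :: real
    and f0 g :: "real \<Rightarrow> real"
    and N :: "form measure"
    and Prior :: "(real \<Rightarrow> real) measure"
    and post :: "nat \<Rightarrow> form \<Rightarrow> (real \<Rightarrow> real) measure"
  assumes basis: "regular_basis S B"
    and s: "1 / 2 < s" "s < real S"
    and \<delta>: "1 / 2 < \<delta>"
    and noise: "white_noise_law B \<delta> N"
    and f0: "f0 \<in> L2"
    and g: "g \<in> sobolev B s" "\<not> (AE x in lebI. g x = 0)"
    and prior: "Prior \<in> space (prob_algebra L2_borel)"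
    and post: "\<And>n. n \<ge> 1 \<Longrightarrow> is_posterior B \<delta> N Prior n (post n)"
    and BvM: "weak_BvM B \<delta> N post f0"
  shows
    "tends_to_0_in_prob (\<lambda>n. obs_law B \<delta> N n f0)
       (\<lambda>n x. bl_dist UNIV dist
          (distr (post_L g (post n x)) borel (\<lambda>z. sqrt (real n) * (z - L_ext B \<delta> g x)))
          (density lborel (normal_density 0 (L2_norm g))))
     \<and> (\<forall>\<alpha> R. 0 < \<alpha> \<and> \<alpha> < 1 \<and>
          cred_radius (\<lambda>n. obs_law B \<delta> N n f0) (\<lambda>n x. post_L g (post n x))
            (\<lambda>n x. L_ext B \<delta> g x) \<alpha> R \<longrightarrow>
          coverage_tends (\<lambda>n. obs_law B \<delta> N n f0) (L2_inner f0 g)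
            (cred_set (\<lambda>n x. L_ext B \<delta> g x) R) (1 - \<alpha>) \<and>
          bounded_in_prob (\<lambda>n. obs_law B \<delta> N n f0) R)
     \<and> (\<forall>fbar.
          is_posterior_mean B \<delta> (\<lambda>n. obs_law B \<delta> N n f0) post fbar \<and>
          tends_to_0_in_prob (\<lambda>n. obs_law B \<delta> N n f0)
            (\<lambda>n x. sqrt (real n) * H_dist B \<delta> (fbar n x) x) \<longrightarrow>
          (\<forall>\<alpha> R. 0 < \<alpha> \<and> \<alpha> < 1 \<and>
             cred_radius (\<lambda>n. obs_law B \<delta> N n f0) (\<lambda>n x. post_L g (post n x))
               (\<lambda>n x. L_ext B \<delta> g (fbar n x)) \<alpha> R \<longrightarrow>
             coverage_tends (\<lambda>n. obs_law B \<delta> N n f0) (L2_inner f0 g)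
               (cred_set (\<lambda>n x. L_ext B \<delta> g (fbar n x)) R) (1 - \<alpha>) \<and>
             bounded_in_prob (\<lambda>n. obs_law B \<delta> N n f0) R) \<and>
          (\<forall>\<alpha> R. 0 < \<alpha> \<and> \<alpha> < 1 \<and>
             cred_radius (\<lambda>n. obs_law B \<delta> N n f0) (\<lambda>n x. post_L g (post n x))
               (\<lambda>n x. L_ext B \<delta> g x) \<alpha> R \<longrightarrow>
             coverage_tends (\<lambda>n. obs_law B \<delta> N n f0) (L2_inner f0 g)
               (cred_set (\<lambda>n x. L_ext B \<delta> g (fbar n x)) R) (1 - \<alpha>)))"
proof -
  have "0 < \<delta>" using \<delta> by simp
  then interpret H_functional B \<delta> g
    using H_functional_sobolev[OF basis s(1) _ g(1)] by simp
  interpret functional_bvm B \<delta> g f0 N post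
  proof
    show "0 < L2_norm g" by (rule L2_norm_pos[OF g_L2 g(2)])
    fix n :: nat and x assume "n \<ge> 1" "x \<in> H_space B \<delta>"
    then show "post n x \<in> space (prob_algebra L2_borel)"
      using post[of n] by (auto simp: is_posterior_def H_borel_def dest: measurable_space)
  qed (fact noise f0 BvM)+
  have centre0: "tends_to_0_in_prob P (\<lambda>n x. sqrt (real n) * (L_ext B \<delta> g x - L_ext B \<delta> g x))"
    by (simp add: tends_to_0_in_prob_def)
  have meas: "R n \<in> borel_measurable (P n)"
    if "cred_radius P (\<lambda>n x. post_L g (post n x)) c \<alpha> R" "n \<ge> 1" for c \<alpha> R n
    using that by (simp add: cred_radius_def)
  have quantile: "\<exists>q>0. normal_central (L2_norm g) q = 1 - \<alpha>" if "0 < \<alpha>" "\<alpha> < 1" for \<alpha>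
    using ex_normal_central_eq[OF g_norm_pos, of "1 - \<alpha>"] that by auto
  \<comment> \<open>The centre \<open>c\<close> calibrates the radius and \<open>c'\<close> locates
    the set. Keeping them apart lets one statement give all three coverage claims.\<close>
  have coverage: "coverage_tends P (L2_inner f0 g) (cred_set c' R) (1 - \<alpha>) \<and> bounded_in_prob P R"
    if \<alpha>: "0 < \<alpha>" "\<alpha> < 1" and R: "cred_radius P (\<lambda>n x. post_L g (post n x)) c \<alpha> R"
      and c: "tends_to_0_in_prob P (\<lambda>n x. sqrt (real n) * (c n x - L_ext B \<delta> g x))"
      and c': "\<And>n. n \<ge> 1 \<Longrightarrow> c' n \<in> borel_measurable (P n)"
        "tends_to_0_in_prob P (\<lambda>n x. sqrt (real n) * (c' n x - L_ext B \<delta> g x))"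
    for \<alpha> R c c'
  proof -
    obtain q where q: "0 < q" "normal_central (L2_norm g) q = 1 - \<alpha>"
      using quantile[OF \<alpha>] by blast
    note Rq = cred_radius_tends[OF q c R]
    show ?thesis
      using cred_set_coverage[OF q c' meas[OF R] Rq] bounded_in_prob_if_tends[OF P_prob meas[OF R] Rq] by blast
  qed
  have mean: "tends_to_0_in_prob P (\<lambda>n x. sqrt (real n) * (L_ext B \<delta> g (fbar n x) - L_ext B \<delta> g x))"
    "n \<ge> 1 \<Longrightarrow> (\<lambda>x. L_ext B \<delta> g (fbar n x)) \<in> borel_measurable (P n)"
    if fbar: "is_posterior_mean B \<delta> P post fbar"
      and lim: "tends_to_0_in_prob P (\<lambda>n x. sqrt (real n) * H_dist B \<delta> (fbar n x) x)" for fbar n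
  proof -
    have m: "fbar n \<in> P n \<rightarrow>\<^sub>M H_borel B \<delta>" if "n \<ge> 1" for n
      using fbar that by (simp add: is_posterior_mean_def)
    show "(\<lambda>x. L_ext B \<delta> g (fbar n x)) \<in> borel_measurable (P n)" if "n \<ge> 1"
      by (rule measurable_compose[OF m[OF that] L_ext_measurable])
    show "tends_to_0_in_prob P (\<lambda>n x. sqrt (real n) * (L_ext B \<delta> g (fbar n x) - L_ext B \<delta> g x))"
    proof (rule tends_to_0_in_prob_transfer[OF lim lim])
      fix e :: real assume e: "e > 0"
      \<comment> \<open>Adding 1 gives a Lipschitz constant that can safely be divided by.\<close>
      have K: "L_const + 1 > 0" using L_const_nonneg by simp
      have "\<bar>sqrt (real n) * (L_ext B \<delta> g (fbar n x) - L_ext B \<delta> g x)\<bar> \<le> e"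
        if n: "n \<ge> 1" and x: "x \<in> space (P n)" and d: "\<bar>sqrt (real n) * H_dist B \<delta> (fbar n x) x\<bar> \<le> e / (L_const + 1)" for n x
      proof -
        have h: "x \<in> H_space B \<delta>" "fbar n x \<in> H_space B \<delta>"
          using x measurable_space[OF m[OF n] x] by (simp_all add: P_space H_borel_def)
        have "\<bar>L_ext B \<delta> g (fbar n x) - L_ext B \<delta> g x\<bar> \<le> L_const * H_dist B \<delta> (fbar n x) x"
          using L_bar_Lipschitz[OF h(2,1)] by (simp add: L_ext_eq_L_bar h)
        also have "\<dots> \<le> (L_const + 1) * H_dist B \<delta> (fbar n x) x"
          by (intro mult_right_mono) (auto simp: H_dist_def H_norm_nonneg)
        finally have "sqrt (real n) * \<bar>L_ext B \<delta> g (fbar n x) - L_ext B \<delta> g x\<bar> \<le>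
            sqrt (real n) * ((L_const + 1) * H_dist B \<delta> (fbar n x) x)"
          by (intro mult_left_mono) auto
        also have "\<dots> = (L_const + 1) * (sqrt (real n) * H_dist B \<delta> (fbar n x) x)" by simp
        also have "\<dots> \<le> (L_const + 1) * (e / (L_const + 1))"
          using d K by (intro mult_left_mono) auto
        also have "\<dots> = e" using K by simp
        finally show ?thesis by (simp add: abs_mult)
      qed
      then show "\<exists>\<eta>>0. \<forall>n\<ge>1. AE x in P n. \<bar>sqrt (real n) * H_dist B \<delta> (fbar n x) x\<bar> \<le> \<eta> \<and>
          \<bar>sqrt (real n) * H_dist B \<delta> (fbar n x) x\<bar> \<le> \<eta> \<longrightarrow>
          \<bar>sqrt (real n) * (L_ext B \<delta> g (fbar n x) - L_ext B \<delta> g x)\<bar> \<le> e"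
        using e K by (intro exI[of _ "e / (L_const + 1)"] conjI allI impI AE_I2) auto
    qed
  qed
  show ?thesis
  proof (intro conjI allI impI; (elim conjE)?)
    show "tends_to_0_in_prob P (\<lambda>n x. bl_dist UNIV dist (std_post n x) limit_law)"
      by (rule std_post_tends)
  next
    fix \<alpha> R assume "0 < \<alpha>" "\<alpha> < 1" "cred_radius P (\<lambda>n x. post_L g (post n x)) (\<lambda>n x. L_ext B \<delta> g x) \<alpha> R"
    from coverage[OF this centre0 L_ext_P_measurable centre0]
    show "coverage_tends P (L2_inner f0 g) (cred_set (\<lambda>n x. L_ext B \<delta> g x) R) (1 - \<alpha>)" "bounded_in_prob P R"
      by blast+
  next
    fix fbar and \<alpha> :: real and R
    assume fbar: "is_posterior_mean B \<delta> P post fbar"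
      "tends_to_0_in_prob P (\<lambda>n x. sqrt (real n) * H_dist B \<delta> (fbar n x) x)"
      and \<alpha>: "0 < \<alpha>" "\<alpha> < 1"
    note mean = mean[OF fbar]
    show "coverage_tends P (L2_inner f0 g) (cred_set (\<lambda>n x. L_ext B \<delta> g (fbar n x)) R) (1 - \<alpha>)"
      "bounded_in_prob P R"
      if "cred_radius P (\<lambda>n x. post_L g (post n x)) (\<lambda>n x. L_ext B \<delta> g (fbar n x)) \<alpha> R"
      using coverage[OF \<alpha> that mean(1) mean(2) mean(1)] by blast+
    \<comment> \<open>The mixed case: the radius is calibrated around the functional of the
      observation, and the interval is then moved to that of the posterior mean.\<close>
    show "coverage_tends P (L2_inner f0 g) (cred_set (\<lambda>n x. L_ext B \<delta> g (fbar n x)) R) (1 - \<alpha>)"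
      if "cred_radius P (\<lambda>n x. post_L g (post n x)) (\<lambda>n x. L_ext B \<delta> g x) \<alpha> R"
      using coverage[OF \<alpha> that centre0 mean(2) mean(1)] by blast
  qed
qed

end
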